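(* Let $\mathbf Y_n=(\mathbf y_1,\dots,\mathbf y_n)=(y_{ij})_{n\times n}$ have i.i.d. $N(0,1)$ entries. Define by Gram–Schmidt $\mathbf w_1=\mathbf y_1$, $\boldsymbol\gamma_1=\mathbf w_1/\|\mathbf w_1\|$, and for $k=2,\dots,n$, $\mathbf w_k=\mathbf y_k-\sum_{i=1}^{k-1}\langle \mathbf y_k,\boldsymbol\gamma_i\rangle\boldsymbol\gamma_i$, $\boldsymbol\gamma_k=\mathbf w_k/\|\mathbf w_k\|$, and set $\boldsymbol\Gamma_n=(\boldsymbol\gamma_1,\dots,\boldsymbol\gamma_n)=(\gamma_{ij})$ (a Haar-distributed orthogonal matrix). For $1\le p,q\le n$ let $\boldsymbol\Gamma_{p\times q}=(\gamma_{ij})_{1\le i\le p,1\le j\le q}$, $\mathbf Y_{p\times q}=(y_{ij})_{1\le i\le p,1\le j\le q}$ and $\|\sqrt n\boldsymbol\Gamma_{p\times q}-\mathbf Y_{p\times q}\|_{\rm HS}^2=\sum_{i=1}^p\sum_{j=1}^q(\sqrt n\gamma_{ij}-y_{ij})^2$. Let $p=p_n$, $q=q_n$ with $1\le p,q\le n$. If $\lim_{n\to\infty}pq^2/n=0$, then $\|\sqrt n\boldsymbol\Gamma_{p\times q}-\mathbf Y_{p\times q}\|_{\rm HS}\to 0$ in probability as $n\to\infty$. If $\lim_{n\to\infty}pq^2/n=\sigma\in(0,\infty)$, then for every $\epsilon\in(0,\sqrt{\sigma/2})$, $$\liminf_{n\to\infty}P\big(\|\sqrt n\boldsymbol\Gamma_{p\times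 q}-\mathbf Y_{p\times q}\|_{\rm HS}\ge\epsilon\big)>0.$$ *)

theory Defs
  imports "HOL-Probability.Probability"
begin

text \<open>An n x n real matrix is modelled as a function (nat \<times> nat) \<Rightarrow> real, entry (i,j)
  with 0-based indices i,j < n.  Column vectors of length n are functions nat \<Rightarrow> real
  (only indices i < n matter).\<close>

definition gauss_matrix :: "nat \<Rightarrow> ((nat \<times> nat) \<Rightarrow> real) measure" where
  "gauss_matrix n = PiM ({..<n} \<times> {..<n}) (\<lambda>_. density lborel std_normal_density)"

definition ip :: "nat \<Rightarrow> (nat \<Rightarrow> real) \<Rightarrow> (nat \<Rightarrow> real) \<Rightarrow> real" where
  "ip n u v = (\<Sum>i<n. u i * v i)"

definition vnorm :: "nat \<Rightarrow> (nat \<Rightarrow> real) \<Rightarrow> real" where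
  "vnorm n u = sqrt (ip n u u)"

definition col :: "((nat \<times> nat) \<Rightarrow> real) \<Rightarrow> nat \<Rightarrow> nat \<Rightarrow> real" where
  "col Y k = (\<lambda>i. Y (i, k))"

fun gs_cols :: "nat \<Rightarrow> ((nat \<times> nat) \<Rightarrow> real) \<Rightarrow> nat \<Rightarrow> (nat \<Rightarrow> real) list" where
  "gs_cols n Y 0 = []"
| "gs_cols n Y (Suc k) =
    (let prev = gs_cols n Y k;
         w = (\<lambda>i. col Y k i - (\<Sum>g\<leftarrow>prev. ip n (col Y k) g * g i))
     in prev @ [(\<lambda>i. w i / vnorm n w)])"

definition gamma :: "nat \<Rightarrow> ((nat \<times> nat) \<Rightarrow> real) \<Rightarrow> nat \<Rightarrow> nat \<Rightarrow> real" where
  "gamma n Y i j = (gs_cols n Y n ! j) i"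

definition hs_dist :: "nat \<Rightarrow> nat \<Rightarrow> nat \<Rightarrow> ((nat \<times> nat) \<Rightarrow> real) \<Rightarrow> real" where
  "hs_dist n p q Y = sqrt (\<Sum>i<p. \<Sum>j<q. (sqrt (real n) * gamma n Y i j - Y (i, j))\<^sup>2)"

end

theory Submission
  imports Defs "HOL-Combinatorics.Transposition"
begin

text \<open>
  The squared distance is \<open>Z\<^sub>p = (\<Sum>i<p. R\<^sub>i)\<close> with \<open>R\<^sub>i\<close> the squared norm of the \<open>i\<close>-th row of
  \<open>sqrt n \<Gamma> - Y\<close>. Gram-Schmidt commutes with orthogonal maps of the rows and the law of \<open>Y\<close> is
  invariant under them. Swapping rows shows that \<open>E R\<^sub>i\<close> and \<open>E (R\<^sub>i R\<^sub>k)\<close>, \<open>i \<noteq> k\<close>, do not depend on the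
  indices, and replacing two rows by their normalized sum and difference bounds \<open>E R\<^sub>i\<^sup>2\<close> by a multiple of \<open>E (R\<^sub>i R\<^sub>k)\<close>. Hence
  \<open>E Z\<^sub>p = (p / n) E Z\<^sub>n\<close> and \<open>E Z\<^sub>p\<^sup>2\<close> is at most a multiple of \<open>(p / n)\<^sup>2 E Z\<^sub>n\<^sup>2\<close>.

  For \<open>p = n\<close> the distance splits over columns into \<open>n - 2 sqrt n \<parallel>w\<^sub>j\<parallel> + \<parallel>y\<^sub>j\<parallel>\<^sup>2\<close>, where
  \<open>\<parallel>w\<^sub>j\<parallel>\<^sup>2 = \<parallel>y\<^sub>j\<parallel>\<^sup>2 - (\<Sum>l<j. \<langle>y\<^sub>j, \<gamma>\<^sub>l\<rangle>\<^sup>2)\<close>. Expanding the square root to third order gives an expectation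
  of \<open>j + 1 / 2 + o(q)\<close> for column \<open>j < q\<close> (counted from 0), so \<open>E Z\<^sub>p\<close> is asymptotically
  \<open>p q\<^sup>2 / (2 n)\<close>, while \<open>E Z\<^sub>p\<^sup>2 = O((p q\<^sup>2 / n)\<^sup>2)\<close>. The two claims follow from the inequalities of
  Markov and Paley-Zygmund.
\<close>

section \<open>Moments of sums of independent variables\<close>

text \<open>\<open>has_bochner_integral\<close> carries integrability and value together. The mean
  is fixed to 0 so that mixed terms containing a first power vanish for independent
  summands.\<close>

definition has_moments :: "'a measure \<Rightarrow> ('a \<Rightarrow> real) \<Rightarrow> real \<Rightarrow> real \<Rightarrow> real \<Rightarrow> bool" where
  "has_moments M X v t f \<longleftrightarrow>
     has_bochner_integral M X 0 \<and> has_bochner_integral M (\<lambda>\<omega>. X \<omega> ^ 2) v \<and>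
     has_bochner_integral M (\<lambda>\<omega>. X \<omega> ^ 3) t \<and> has_bochner_integral M (\<lambda>\<omega>. X \<omega> ^ 4) f"

lemma (in prob_space) has_bochner_integral_indep_mult:
  fixes X Y :: "'a \<Rightarrow> real"
  assumes "indep_var borel X borel Y"
    and "has_bochner_integral M (\<lambda>\<omega>. X \<omega> ^ a) x" and "has_bochner_integral M (\<lambda>\<omega>. Y \<omega> ^ b) y"
  shows "has_bochner_integral M (\<lambda>\<omega>. X \<omega> ^ a * Y \<omega> ^ b) (x * y)"
proof -
  have "indep_var borel ((\<lambda>x. x ^ a) \<circ> X) borel ((\<lambda>x. x ^ b) \<circ> Y)"
    by (rule indep_var_compose[OF assms(1)]) auto
  then have ind: "indep_var borel (\<lambda>\<omega>. X \<omega> ^ a) borel (\<lambda>\<omega>. Y \<omega> ^ b)"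
    by (simp add: comp_def)
  show ?thesis
    using indep_var_lebesgue_integral[OF ind] indep_var_integrable[OF ind] assms(2,3)
    by (auto simp: has_bochner_integral_iff)
qed

lemma (in prob_space) has_moments_add:
  assumes ind: "indep_var borel X borel Y"
    and X: "has_moments M X v t f" and Y: "has_moments M Y v' t' f'"
  shows "has_moments M (\<lambda>\<omega>. X \<omega> + Y \<omega>) (v + v') (t + t') (f + f' + 6 * v * v')"
proof -
  note mult = has_bochner_integral_indep_mult[OF ind]
  have X': "has_bochner_integral M (\<lambda>\<omega>. X \<omega> ^ 1) 0" "has_bochner_integral M (\<lambda>\<omega>. X \<omega> ^ 2) v"
    "has_bochner_integral M (\<lambda>\<omega>. X \<omega> ^ 3) t" "has_bochner_integral M (\<lambda>\<omega>. X \<omega> ^ 4) f"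
    using X by (auto simp: has_moments_def)
  have Y': "has_bochner_integral M (\<lambda>\<omega>. Y \<omega> ^ 1) 0" "has_bochner_integral M (\<lambda>\<omega>. Y \<omega> ^ 2) v'"
    "has_bochner_integral M (\<lambda>\<omega>. Y \<omega> ^ 3) t'" "has_bochner_integral M (\<lambda>\<omega>. Y \<omega> ^ 4) f'"
    using Y by (auto simp: has_moments_def)
  have "has_bochner_integral M (\<lambda>\<omega>. X \<omega> ^ 1 + Y \<omega> ^ 1) (0 + 0)"
    using X' Y' by (intro has_bochner_integral_add)
  moreover have "has_bochner_integral M
      (\<lambda>\<omega>. X \<omega> ^ 2 + (2 * (X \<omega> ^ 1 * Y \<omega> ^ 1) + Y \<omega> ^ 2)) (v + (2 * (0 * 0) + v'))"
    using mult[OF X'(1) Y'(1)] X' Y' by (intro has_bochner_integral_add has_bochner_integral_mult_right) auto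
  moreover have "has_bochner_integral M
      (\<lambda>\<omega>. X \<omega> ^ 3 + (3 * (X \<omega> ^ 2 * Y \<omega> ^ 1) + (3 * (X \<omega> ^ 1 * Y \<omega> ^ 2) + Y \<omega> ^ 3)))
      (t + (3 * (v * 0) + (3 * (0 * v') + t')))"
    using mult[OF X'(2) Y'(1)] mult[OF X'(1) Y'(2)] X' Y'
    by (intro has_bochner_integral_add has_bochner_integral_mult_right) auto
  moreover have "has_bochner_integral M
      (\<lambda>\<omega>. X \<omega> ^ 4 + (4 * (X \<omega> ^ 3 * Y \<omega> ^ 1) + (6 * (X \<omega> ^ 2 * Y \<omega> ^ 2) + (4 * (X \<omega> ^ 1 * Y \<omega> ^ 3) + Y \<omega> ^ 4))))
      (f + (4 * (t * 0) + (6 * (v * v') + (4 * (0 * t') + f'))))"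
    using mult[OF X'(3) Y'(1)] mult[OF X'(2) Y'(2)] mult[OF X'(1) Y'(3)] X' Y'
    by (intro has_bochner_integral_add has_bochner_integral_mult_right) auto
  moreover have "(X \<omega> + Y \<omega>) ^ 2 = X \<omega> ^ 2 + (2 * (X \<omega> ^ 1 * Y \<omega> ^ 1) + Y \<omega> ^ 2)"
    "(X \<omega> + Y \<omega>) ^ 3 = X \<omega> ^ 3 + (3 * (X \<omega> ^ 2 * Y \<omega> ^ 1) + (3 * (X \<omega> ^ 1 * Y \<omega> ^ 2) + Y \<omega> ^ 3))"
    "(X \<omega> + Y \<omega>) ^ 4 = X \<omega> ^ 4 + (4 * (X \<omega> ^ 3 * Y \<omega> ^ 1) + (6 * (X \<omega> ^ 2 * Y \<omega> ^ 2) + (4 * (X \<omega> ^ 1 * Y \<omega> ^ 3) + Y \<omega> ^ 4)))"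
    for \<omega> by (simp_all add: algebra_simps power2_eq_square power3_eq_cube power4_eq_xxxx)
  ultimately show ?thesis
    by (simp add: has_moments_def algebra_simps)
qed

text \<open>For independent centred variables the variance, the third moment and the fourth cumulant
  \<open>f - 3 * v ^ 2\<close> are additive; the fourth moment is recovered from the last
  one.\<close>

lemma (in prob_space) has_moments_sum:
  assumes "finite J" "indep_vars (\<lambda>_. borel) X J"
    and "\<And>i. i \<in> J \<Longrightarrow> has_moments M (X i) (v i) (t i) (f i)"
  shows "has_moments M (\<lambda>\<omega>. \<Sum>i\<in>J. X i \<omega>) (\<Sum>i\<in>J. v i) (\<Sum>i\<in>J. t i)
    ((\<Sum>i\<in>J. f i - 3 * v i ^ 2) + 3 * (\<Sum>i\<in>J. v i) ^ 2)"
  using assms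
proof (induction J rule: finite_induct)
  case empty
  then show ?case by (simp add: has_moments_def has_bochner_integral_zero)
next
  case (insert i J)
  have "has_moments M (\<lambda>\<omega>. X i \<omega> + (\<Sum>i\<in>J. X i \<omega>)) (v i + (\<Sum>i\<in>J. v i)) (t i + (\<Sum>i\<in>J. t i))
    (f i + ((\<Sum>i\<in>J. f i - 3 * v i ^ 2) + 3 * (\<Sum>i\<in>J. v i) ^ 2) + 6 * v i * (\<Sum>i\<in>J. v i))"
    using insert by (intro has_moments_add indep_vars_sum insert.IH) (auto intro: indep_vars_subset)
  then show ?case
    using insert by (simp add: algebra_simps power2_eq_square)
qed

text \<open>The joint law of the coordinates is the product measure itself. This criterion for
  independence concerns nonempty index sets, hence the case split.\<close>

lemma indep_vars_PiM_coordinate: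
  assumes "\<And>i. i \<in> K \<Longrightarrow> prob_space (M i)"
  shows "prob_space.indep_vars (PiM K M) M (\<lambda>i y. y i) K"
proof (cases "K = {}")
  case True
  interpret prob_space "PiM K M" by (intro prob_space_PiM assms)
  show ?thesis unfolding indep_vars_def indep_sets_def by (simp add: True)
next
  case False
  interpret prob_space "PiM K M" by (intro prob_space_PiM assms)
  have "distr (PiM K M) (PiM K M) (\<lambda>x. \<lambda>i\<in>K. x i) = distr (PiM K M) (PiM K M) (\<lambda>x. x)"
    by (intro distr_cong) (auto simp: space_PiM)
  also have "\<dots> = PiM K (\<lambda>i. distr (PiM K M) (M i) (\<lambda>y. y i))"
    unfolding distr_id2[OF refl] by (intro PiM_cong distr_PiM_component[symmetric] assms) auto
  finally show ?thesis
    using False by (subst indep_vars_iff_distr_eq_PiM') auto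
qed

lemma has_moments_PiM_sum:
  assumes N: "prob_space N" and fin: "finite J" and JK: "J \<subseteq> K"
    and h: "\<And>i. i \<in> J \<Longrightarrow> has_moments N (h i) (v i) (t i) (f i)"
  shows "has_moments (PiM K (\<lambda>_. N)) (\<lambda>y. \<Sum>i\<in>J. h i (y i)) (\<Sum>i\<in>J. v i) (\<Sum>i\<in>J. t i)
    ((\<Sum>i\<in>J. f i - 3 * v i ^ 2) + 3 * (\<Sum>i\<in>J. v i) ^ 2)"
proof -
  interpret prob_space "PiM K (\<lambda>_. N)" by (intro prob_space_PiM N)
  have hm: "h i \<in> borel_measurable N" if "i \<in> J" for i
    using h[OF that] by (auto simp: has_moments_def has_bochner_integral_iff)
  have "indep_vars (\<lambda>_. N) (\<lambda>i y. y i) J"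
    using indep_vars_subset[OF indep_vars_PiM_coordinate[of K "\<lambda>_. N", OF N] JK] .
  then have ind: "indep_vars (\<lambda>_. borel) (\<lambda>i y. h i (y i)) J"
    by (rule indep_vars_compose2) (rule hm)
  have tr: "has_bochner_integral (PiM K (\<lambda>_. N)) (\<lambda>y. g (y i)) x"
    if i: "i \<in> J" and g: "has_bochner_integral N g x" for g :: "_ \<Rightarrow> real" and x i
  proof -
    have "distr (PiM K (\<lambda>_. N)) N (\<lambda>y. y i) = N"
      using i JK distr_PiM_component[of K "\<lambda>_. N" i] N by blast
    moreover have "(\<lambda>y. y i) \<in> measurable (PiM K (\<lambda>_. N)) N"
      using i JK by (intro measurable_component_singleton) auto
    moreover have "g \<in> borel_measurable N" using g by auto
    ultimately show ?thesis
      using g by (metis has_bochner_integral_iff integrable_distr_eq integral_distr)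
  qed
  show ?thesis
  proof (rule has_moments_sum[OF fin ind])
    fix i assume i: "i \<in> J"
    show "has_moments (PiM K (\<lambda>_. N)) (\<lambda>y. h i (y i)) (v i) (t i) (f i)"
      using h[OF i] unfolding has_moments_def by (auto intro!: tr[OF i])
  qed
qed

section \<open>Moments of the standard Gaussian law\<close>

abbreviation std_gauss :: "real measure" where
  "std_gauss \<equiv> density lborel std_normal_density"

lemma prob_space_std_gauss: "prob_space std_gauss"
  by (rule prob_space_normal_density) simp

lemma std_gauss_moments:
  "has_bochner_integral std_gauss (\<lambda>x. x ^ (2 * k)) (fact (2 * k) / (2 ^ k * fact k))"
  "has_bochner_integral std_gauss (\<lambda>x. x ^ (2 * k + 1)) 0"
  using std_normal_moment_even[of k] std_normal_moment_odd[of k]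
  by (auto intro!: has_bochner_integral_density simp: normal_density_nonneg)

lemma has_moments_linear: "has_moments std_gauss (\<lambda>x. a * x) (a ^ 2) 0 (3 * a ^ 4)"
proof -
  have m: "has_bochner_integral std_gauss (\<lambda>x. x) 0" "has_bochner_integral std_gauss (\<lambda>x. x ^ 2) 1"
    "has_bochner_integral std_gauss (\<lambda>x. x ^ 3) 0" "has_bochner_integral std_gauss (\<lambda>x. x ^ 4) 3"
    using std_gauss_moments(2)[of 0] std_gauss_moments(1)[of 1] std_gauss_moments(2)[of 1]
      std_gauss_moments(1)[of 2]
    by (simp_all add: fact_numeral)
  have "has_bochner_integral std_gauss (\<lambda>x. a * x) (a * 0)"
    "has_bochner_integral std_gauss (\<lambda>x. a ^ 2 * x ^ 2) (a ^ 2 * 1)"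
    "has_bochner_integral std_gauss (\<lambda>x. a ^ 3 * x ^ 3) (a ^ 3 * 0)"
    "has_bochner_integral std_gauss (\<lambda>x. a ^ 4 * x ^ 4) (a ^ 4 * 3)"
    by (intro has_bochner_integral_mult_right m)+
  then show ?thesis
    by (simp add: has_moments_def power_mult_distrib mult.commute)
qed

text \<open>The centred chi-square law with one degree of freedom; its moments follow from the even
  Gaussian moments 1, 3, 15, 105 by expanding powers.\<close>

lemma has_moments_square: "has_moments std_gauss (\<lambda>x. x ^ 2 - 1) 2 8 60"
proof -
  have m: "has_bochner_integral std_gauss (\<lambda>x. 1::real) (1::real)" "has_bochner_integral std_gauss (\<lambda>x. x ^ 2) 1"
    "has_bochner_integral std_gauss (\<lambda>x. x ^ 4) 3" "has_bochner_integral std_gauss (\<lambda>x. x ^ 6) 15"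
    "has_bochner_integral std_gauss (\<lambda>x. x ^ 8) 105"
    using std_gauss_moments(1)[of 0] std_gauss_moments(1)[of 1] std_gauss_moments(1)[of 2]
      std_gauss_moments(1)[of 3] std_gauss_moments(1)[of 4]
    by (simp_all add: fact_numeral)
  have "has_bochner_integral std_gauss (\<lambda>x. x ^ 2 - 1) (1 - 1)"
    "has_bochner_integral std_gauss (\<lambda>x. (x ^ 4 - 2 * x ^ 2) + 1) ((3 - 2 * 1) + 1)"
    "has_bochner_integral std_gauss (\<lambda>x. (x ^ 6 - 3 * x ^ 4) + (3 * x ^ 2 - 1)) ((15 - 3 * 3) + (3 * 1 - 1))"
    "has_bochner_integral std_gauss (\<lambda>x. (x ^ 8 - 4 * x ^ 6) + (6 * x ^ 4 - 4 * x ^ 2) + 1)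
      ((105 - 4 * 15) + (6 * 3 - 4 * 1) + 1)"
    by (intro has_bochner_integral_add has_bochner_integral_diff has_bochner_integral_mult_right m)+
  moreover have "(x ^ 2 - 1) ^ 2 = (x ^ 4 - 2 * x ^ 2) + 1"
    "(x ^ 2 - 1) ^ 3 = (x ^ 6 - 3 * x ^ 4) + (3 * x ^ 2 - 1)"
    "(x ^ 2 - 1) ^ 4 = (x ^ 8 - 4 * x ^ 6) + (6 * x ^ 4 - 4 * x ^ 2) + 1" for x :: real
    by (simp_all add: algebra_simps eval_nat_numeral)
  ultimately show ?thesis
    by (simp add: has_moments_def)
qed

section \<open>Reflection invariance of Gaussian matrices\<close>

text \<open>The map is a symmetric orthogonal reflection of the plane. Two one-dimensional affine
  substitutions with Fubini in between replace a planar change of variables; \<beta> > 0 permits the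
  divisions. The cases used later are the swap (\<alpha> = 0, \<beta> = 1) and \<alpha> = \<beta> =
  1 / sqrt 2.\<close>

lemma nn_integral_gauss_reflection:
  assumes ab: "\<alpha>\<^sup>2 + \<beta>\<^sup>2 = 1" and \<beta>: "0 < \<beta>"
    and f[measurable]: "f \<in> borel_measurable (borel \<Otimes>\<^sub>M borel)"
  shows "(\<integral>\<^sup>+x. \<integral>\<^sup>+y. f (\<alpha> * x + \<beta> * y, \<beta> * x - \<alpha> * y) \<partial>std_gauss \<partial>std_gauss)
    = (\<integral>\<^sup>+u. \<integral>\<^sup>+v. f (u, v) \<partial>std_gauss \<partial>std_gauss)"
proof -
  let ?\<phi> = "\<lambda>x. ennreal (std_normal_density x)"
  have bb: "\<beta> * \<beta> = 1 - \<alpha> * \<alpha>" using ab by (simp add: power2_eq_square algebra_simps)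
  have "(\<integral>\<^sup>+x. \<integral>\<^sup>+y. f (\<alpha> * x + \<beta> * y, \<beta> * x - \<alpha> * y) \<partial>std_gauss \<partial>std_gauss)
    = (\<integral>\<^sup>+x. \<integral>\<^sup>+y. ?\<phi> x * ?\<phi> y * f (\<alpha> * x + \<beta> * y, \<beta> * x - \<alpha> * y) \<partial>lborel \<partial>lborel)"
    by (simp add: nn_integral_density nn_integral_cmult[symmetric] mult.assoc)
  \<comment> \<open>First substitution, for fixed \<open>x\<close>:
    \<open>u = \<alpha> * x + \<beta> * y\<close>, with Jacobian 1 / \<beta>.\<close>
  also have "\<dots> = (\<integral>\<^sup>+x. ennreal (1/\<beta>) * (\<integral>\<^sup>+u. ?\<phi> x * ?\<phi> ((u - \<alpha> * x) / \<beta>) * f (u, (x - \<alpha> * u) / \<beta>) \<partial>lborel) \<partial>lborel)"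
  proof (rule nn_integral_cong)
    fix x
    have e: "\<beta> * x - \<alpha> * ((u - \<alpha> * x) / \<beta>) = (x - \<alpha> * u) / \<beta>" for u
    proof -
      have "\<beta> * x - \<alpha> * ((u - \<alpha> * x) / \<beta>) = ((\<beta> * \<beta> + \<alpha> * \<alpha>) * x - \<alpha> * u) / \<beta>"
        using \<beta> by (simp add: field_simps)
      then show ?thesis by (simp add: bb)
    qed
    show "(\<integral>\<^sup>+y. ?\<phi> x * ?\<phi> y * f (\<alpha> * x + \<beta> * y, \<beta> * x - \<alpha> * y) \<partial>lborel)
      = ennreal (1/\<beta>) * (\<integral>\<^sup>+u. ?\<phi> x * ?\<phi> ((u - \<alpha> * x) / \<beta>) * f (u, (x - \<alpha> * u) / \<beta>) \<partial>lborel)"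
    proof -
      have t: "- \<alpha> * x / \<beta> + 1 / \<beta> * u = (u - \<alpha> * x) / \<beta>" for u
        by (simp add: diff_divide_distrib)
      have s: "\<alpha> * x + \<beta> * ((u - \<alpha> * x) / \<beta>) = u" for u
        using \<beta> by simp
      have "(\<integral>\<^sup>+y. ?\<phi> x * ?\<phi> y * f (\<alpha> * x + \<beta> * y, \<beta> * x - \<alpha> * y) \<partial>lborel)
        = ennreal \<bar>1 / \<beta>\<bar> * (\<integral>\<^sup>+u. ?\<phi> x * ?\<phi> (- \<alpha> * x / \<beta> + 1 / \<beta> * u) *
            f (\<alpha> * x + \<beta> * (- \<alpha> * x / \<beta> + 1 / \<beta> * u), \<beta> * x - \<alpha> * (- \<alpha> * x / \<beta> + 1 / \<beta> * u)) \<partial>lborel)"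
        using \<beta> by (intro nn_integral_real_affine) auto
      then show ?thesis
        unfolding t s e using \<beta> by simp
    qed
  qed
  also have "\<dots> = (\<integral>\<^sup>+x. \<integral>\<^sup>+u. ennreal (1/\<beta>) * (?\<phi> x * ?\<phi> ((u - \<alpha> * x) / \<beta>) * f (u, (x - \<alpha> * u) / \<beta>)) \<partial>lborel \<partial>lborel)"
    by (simp add: nn_integral_cmult)
  also have "\<dots> = (\<integral>\<^sup>+u. \<integral>\<^sup>+x. ennreal (1/\<beta>) * (?\<phi> x * ?\<phi> ((u - \<alpha> * x) / \<beta>) * f (u, (x - \<alpha> * u) / \<beta>)) \<partial>lborel \<partial>lborel)"
    by (rule lborel_pair.Fubini') simp
  \<comment> \<open>Second substitution, for fixed \<open>u\<close>:
    \<open>x = \<alpha> * u + \<beta> * v\<close>, whose Jacobian \<beta> cancels 1 /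
    \<beta>.\<close>
  also have "\<dots> = (\<integral>\<^sup>+u. \<integral>\<^sup>+v. ?\<phi> u * ?\<phi> v * f (u, v) \<partial>lborel \<partial>lborel)"
  proof (rule nn_integral_cong)
    fix u
    have e: "(u - \<alpha> * (\<alpha> * u + \<beta> * v)) / \<beta> = \<beta> * u - \<alpha> * v" for v
    proof -
      have "(u - \<alpha> * (\<alpha> * u + \<beta> * v)) / \<beta> = ((1 - \<alpha> * \<alpha>) * u - \<alpha> * \<beta> * v) / \<beta>"
        by (simp add: algebra_simps)
      also have "\<dots> = \<beta> * u - \<alpha> * v"
        unfolding bb[symmetric] using \<beta> by (simp add: field_simps)
      finally show ?thesis .
    qed
    \<comment> \<open>The product of the two densities depends only on the sum of squares, which the
      reflection preserves.\<close>
    have d: "std_normal_density (\<alpha> * u + \<beta> * v) * std_normal_density (\<beta> * u - \<alpha> * v)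
        = std_normal_density u * std_normal_density v" for v
    proof -
      have "(\<alpha> * u + \<beta> * v)\<^sup>2 + (\<beta> * u - \<alpha> * v)\<^sup>2 = (\<alpha>\<^sup>2 + \<beta>\<^sup>2) * (u\<^sup>2 + v\<^sup>2)"
        by (simp add: power2_eq_square algebra_simps)
      then have "- (\<alpha> * u + \<beta> * v)\<^sup>2 / 2 + - (\<beta> * u - \<alpha> * v)\<^sup>2 / 2 = - u\<^sup>2 / 2 + - v\<^sup>2 / 2"
        using ab by simp
      then show ?thesis
        unfolding std_normal_density_def
        by (simp add: exp_add[symmetric] field_simps)
    qed
    have "(\<integral>\<^sup>+x. ennreal (1/\<beta>) * (?\<phi> x * ?\<phi> ((u - \<alpha> * x) / \<beta>) * f (u, (x - \<alpha> * u) / \<beta>)) \<partial>lborel)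
      = ennreal \<beta> * (\<integral>\<^sup>+v. ennreal (1/\<beta>) * (?\<phi> (\<alpha> * u + \<beta> * v) * ?\<phi> ((u - \<alpha> * (\<alpha> * u + \<beta> * v)) / \<beta>) *
          f (u, ((\<alpha> * u + \<beta> * v) - \<alpha> * u) / \<beta>)) \<partial>lborel)"
      using \<beta> by (subst nn_integral_real_affine[where c="\<beta>" and t="\<alpha> * u"]) auto
    also have "\<dots> = ennreal \<beta> * (\<integral>\<^sup>+v. ennreal (1/\<beta>) * (?\<phi> u * ?\<phi> v * f (u, v)) \<partial>lborel)"
      using \<beta> by (simp add: e ennreal_mult'[symmetric] d)
    also have "\<dots> = (\<integral>\<^sup>+v. ?\<phi> u * ?\<phi> v * f (u, v) \<partial>lborel)"
      using \<beta> by (subst nn_integral_cmult) (simp_all add: mult.assoc[symmetric] ennreal_mult'[symmetric])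
    finally show "(\<integral>\<^sup>+x. ennreal (1/\<beta>) * (?\<phi> x * ?\<phi> ((u - \<alpha> * x) / \<beta>) * f (u, (x - \<alpha> * u) / \<beta>)) \<partial>lborel)
      = (\<integral>\<^sup>+v. ?\<phi> u * ?\<phi> v * f (u, v) \<partial>lborel)" .
  qed
  also have "\<dots> = (\<integral>\<^sup>+u. \<integral>\<^sup>+v. f (u, v) \<partial>std_gauss \<partial>std_gauss)"
    by (simp add: nn_integral_density nn_integral_cmult[symmetric] mult.assoc)
  finally show ?thesis .
qed


text \<open>Fubini with the coordinates \<open>a\<close> and \<open>b\<close> innermost reduces the
  claim to the planar case, the other coordinates being frozen.\<close>

lemma nn_integral_PiM_reflection:
  assumes ab: "\<alpha>\<^sup>2 + \<beta>\<^sup>2 = 1" "0 < \<beta>" and I: "finite I" "a \<in> I" "b \<in> I" "a \<noteq> b"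
    and f[measurable]: "f \<in> borel_measurable (PiM I (\<lambda>_. std_gauss))"
  shows "(\<integral>\<^sup>+Y. f (Y(a := \<alpha> * Y a + \<beta> * Y b, b := \<beta> * Y a - \<alpha> * Y b)) \<partial>PiM I (\<lambda>_. std_gauss))
    = (\<integral>\<^sup>+Y. f Y \<partial>PiM I (\<lambda>_. std_gauss))"
proof -
  interpret prob_space std_gauss by (rule prob_space_std_gauss)
  interpret product_sigma_finite "\<lambda>_. std_gauss" by standard
  define J where "J = I - {a, b}"
  have IJ: "I = insert b (insert a J)" and J: "finite J" "a \<notin> J" "b \<notin> insert a J"
    using I by (auto simp: J_def)
  have split: "(\<integral>\<^sup>+Y. g Y \<partial>PiM I (\<lambda>_. std_gauss))
      = (\<integral>\<^sup>+z. \<integral>\<^sup>+x. \<integral>\<^sup>+y. g (z(a := x, b := y)) \<partial>std_gauss \<partial>std_gauss \<partial>PiM J (\<lambda>_. std_gauss))"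
    if [measurable]: "g \<in> borel_measurable (PiM I (\<lambda>_. std_gauss))" for g
  proof -
    have g: "g \<in> borel_measurable (PiM (insert b (insert a J)) (\<lambda>_. std_gauss))"
      using that by (simp add: IJ)
    note [measurable] = g
    have "(\<lambda>z. \<integral>\<^sup>+y. g (z(b := y)) \<partial>std_gauss) \<in> borel_measurable (PiM (insert a J) (\<lambda>_. std_gauss))"
      by measurable
    then show ?thesis
      unfolding IJ using J by (simp add: product_nn_integral_insert[OF _ _ g] product_nn_integral_insert)
  qed
  have "(\<lambda>Y. Y(a := \<alpha> * Y a + \<beta> * Y b, b := \<beta> * Y a - \<alpha> * Y b))
      \<in> measurable (PiM I (\<lambda>_. std_gauss)) (PiM I (\<lambda>_. std_gauss))"
  proof (rule measurable_PiM_single')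
    fix c assume "c \<in> I"
    then have "(\<lambda>Y. if c = b then \<beta> * Y a - \<alpha> * Y b else if c = a then \<alpha> * Y a + \<beta> * Y b else Y c)
      \<in> measurable (PiM I (\<lambda>_. std_gauss)) borel" (is "?g \<in> _")
      using I by auto
    then show "(\<lambda>Y. (Y(a := \<alpha> * Y a + \<beta> * Y b, b := \<beta> * Y a - \<alpha> * Y b)) c)
      \<in> measurable (PiM I (\<lambda>_. std_gauss)) std_gauss"
      by (simp add: fun_upd_def if_distrib cong: measurable_cong_sets if_cong)
  qed (use I in \<open>auto simp: space_PiM PiE_def extensional_def\<close>)
  then have m: "(\<lambda>Y. f (Y(a := \<alpha> * Y a + \<beta> * Y b, b := \<beta> * Y a - \<alpha> * Y b)))
      \<in> borel_measurable (PiM I (\<lambda>_. std_gauss))"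
    by (rule measurable_compose) (rule f)
  have "(\<integral>\<^sup>+Y. f (Y(a := \<alpha> * Y a + \<beta> * Y b, b := \<beta> * Y a - \<alpha> * Y b)) \<partial>PiM I (\<lambda>_. std_gauss))
    = (\<integral>\<^sup>+z. \<integral>\<^sup>+x. \<integral>\<^sup>+y. f (z(a := \<alpha> * x + \<beta> * y, b := \<beta> * x - \<alpha> * y)) \<partial>std_gauss \<partial>std_gauss
        \<partial>PiM J (\<lambda>_. std_gauss))"
    using I by (subst split[OF m]) (simp add: fun_upd_twist)
  also have "\<dots> = (\<integral>\<^sup>+z. \<integral>\<^sup>+x. \<integral>\<^sup>+y. f (z(a := x, b := y)) \<partial>std_gauss \<partial>std_gauss
        \<partial>PiM J (\<lambda>_. std_gauss))"
  proof (rule nn_integral_cong)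
    fix z assume z: "z \<in> space (PiM J (\<lambda>_. std_gauss))"
    have [measurable]: "f \<in> borel_measurable (PiM (insert b (insert a J)) (\<lambda>_. std_gauss))"
      using f by (simp add: IJ)
    have "(\<lambda>p. f (z(a := fst p, b := snd p))) \<in> borel_measurable (std_gauss \<Otimes>\<^sub>M std_gauss)"
      using z by measurable
    then have "(\<lambda>p. f (z(a := fst p, b := snd p))) \<in> borel_measurable (borel \<Otimes>\<^sub>M borel)"
      by (simp cong: measurable_cong_sets sets_pair_measure_cong)
    from nn_integral_gauss_reflection[OF ab this]
    show "(\<integral>\<^sup>+x. \<integral>\<^sup>+y. f (z(a := \<alpha> * x + \<beta> * y, b := \<beta> * x - \<alpha> * y)) \<partial>std_gauss \<partial>std_gauss)
      = (\<integral>\<^sup>+x. \<integral>\<^sup>+y. f (z(a := x, b := y)) \<partial>std_gauss \<partial>std_gauss)" by simp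
  qed
  also have "\<dots> = (\<integral>\<^sup>+Y. f Y \<partial>PiM I (\<lambda>_. std_gauss))"
    by (rule split[symmetric, OF f])
  finally show ?thesis .
qed

section \<open>Reflections of matrix rows\<close>

definition reflect :: "nat \<Rightarrow> nat \<Rightarrow> real \<Rightarrow> real \<Rightarrow> (nat \<Rightarrow> real) \<Rightarrow> nat \<Rightarrow> real" where
  "reflect i k \<alpha> \<beta> u =
    (\<lambda>r. if r = i then \<alpha> * u i + \<beta> * u k else if r = k then \<beta> * u i - \<alpha> * u k else u r)"

text \<open>The parameter \<open>C\<close> restricts the reflection to some columns, so that
  invariance of the law can be proved by adding one column at a time; the applications take all
  columns.\<close>

definition reflect_rows ::
    "nat \<Rightarrow> nat \<Rightarrow> real \<Rightarrow> real \<Rightarrow> nat set \<Rightarrow> (nat \<times> nat \<Rightarrow> real) \<Rightarrow> nat \<times> nat \<Rightarrow> real" where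
  "reflect_rows i k \<alpha> \<beta> C Y = (\<lambda>(r, c). if c \<in> C then reflect i k \<alpha> \<beta> (col Y c) r else Y (r, c))"

lemma sets_gauss_matrix: "sets (gauss_matrix n) = sets (PiM ({..<n} \<times> {..<n}) (\<lambda>_. borel))"
  unfolding gauss_matrix_def by (rule sets_PiM_cong) auto

lemma measurable_gauss_matrix_component [measurable]:
  "i < n \<Longrightarrow> j < n \<Longrightarrow> (\<lambda>Y. Y (i, j)) \<in> borel_measurable (gauss_matrix n)"
  by (simp add: measurable_cong_sets[OF sets_gauss_matrix refl])

lemma measurable_reflect_rows:
  assumes "i < n" "k < n" "C \<subseteq> {..<n}"
  shows "reflect_rows i k \<alpha> \<beta> C \<in> measurable (gauss_matrix n) (gauss_matrix n)"
proof -
  have "(\<lambda>Y. reflect_rows i k \<alpha> \<beta> C Y)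
      \<in> measurable (gauss_matrix n) (PiM ({..<n} \<times> {..<n}) (\<lambda>_. borel))"
  proof (rule measurable_PiM_single')
    fix x assume x: "x \<in> {..<n} \<times> {..<n}"
    then show "(\<lambda>Y. reflect_rows i k \<alpha> \<beta> C Y x) \<in> borel_measurable (gauss_matrix n)"
      using assms by (cases x; cases "snd x \<in> C"; cases "fst x = i"; cases "fst x = k")
        (auto simp: reflect_rows_def reflect_def col_def)
  qed (use assms in \<open>auto simp: gauss_matrix_def space_PiM PiE_def extensional_def reflect_rows_def
        reflect_def col_def\<close>)
  then show ?thesis
    by (simp add: measurable_cong_sets[OF refl sets_gauss_matrix])
qed

lemma nn_integral_reflect_rows:
  assumes ab: "\<alpha>\<^sup>2 + \<beta>\<^sup>2 = 1" "0 < \<beta>" and ik: "i < n" "k < n" "i \<noteq> k" and C: "C \<subseteq> {..<n}"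
    and f: "f \<in> borel_measurable (gauss_matrix n)"
  shows "(\<integral>\<^sup>+Y. f (reflect_rows i k \<alpha> \<beta> C Y) \<partial>gauss_matrix n) = (\<integral>\<^sup>+Y. f Y \<partial>gauss_matrix n)"
proof -
  have "finite C" using C by (rule finite_subset) simp
  then show ?thesis
    using C f
  proof (induction C arbitrary: f rule: finite_induct)
    case empty
    then show ?case by (simp add: reflect_rows_def)
  next
    case (insert c C)
    \<comment> \<open>Within a single column the reflection alters only two entries, which is the
      situation of \<open>nn_integral_PiM_reflection\<close>.\<close>
    define g where "g Y = f (Y((i, c) := \<alpha> * Y (i, c) + \<beta> * Y (k, c), (k, c) := \<beta> * Y (i, c) - \<alpha> * Y (k, c)))" for Y
    have g: "g Y = f (reflect_rows i k \<alpha> \<beta> {c} Y)" for Y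
      unfolding g_def using ik
      by (intro arg_cong[where f=f]) (auto simp: fun_eq_iff reflect_rows_def reflect_def col_def)
    have gm: "g \<in> borel_measurable (gauss_matrix n)"
      unfolding g using insert.prems ik
      by (intro measurable_compose[OF measurable_reflect_rows]) auto
    have "f (reflect_rows i k \<alpha> \<beta> (insert c C) Y) = g (reflect_rows i k \<alpha> \<beta> C Y)" for Y
      unfolding g using insert.hyps ik
      by (intro arg_cong[where f=f]) (auto simp: fun_eq_iff reflect_rows_def reflect_def col_def)
    then have "(\<integral>\<^sup>+Y. f (reflect_rows i k \<alpha> \<beta> (insert c C) Y) \<partial>gauss_matrix n)
        = (\<integral>\<^sup>+Y. g Y \<partial>gauss_matrix n)"
      using insert.IH[OF _ gm] insert.prems by simp
    also have "\<dots> = (\<integral>\<^sup>+Y. f Y \<partial>gauss_matrix n)"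
      unfolding g_def gauss_matrix_def using insert.prems ik
      by (intro nn_integral_PiM_reflection[OF ab]) (auto simp: gauss_matrix_def)
    finally show ?case .
  qed
qed

section \<open>Gram-Schmidt orthogonalization\<close>

lemma ip_commute: "ip n u v = ip n v u"
  by (simp add: ip_def mult.commute)

lemma ip_cong: "(\<And>i. i < n \<Longrightarrow> u i = u' i) \<Longrightarrow> (\<And>i. i < n \<Longrightarrow> v i = v' i) \<Longrightarrow> ip n u v = ip n u' v'"
  by (simp add: ip_def)

lemma ip_diff_sum_left:
  "ip n (\<lambda>i. u i - (\<Sum>m\<in>A. c m * v m i)) x = ip n u x - (\<Sum>m\<in>A. c m * ip n (v m) x)"
proof -
  have "(\<Sum>i<n. (\<Sum>m\<in>A. c m * v m i) * x i) = (\<Sum>m\<in>A. c m * (\<Sum>i<n. v m i * x i))"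
    by (simp add: sum_distrib_left sum_distrib_right mult.assoc) (rule sum.swap)
  then show ?thesis
    by (simp add: ip_def left_diff_distrib sum_subtractf)
qed

lemma ip_divide: "ip n (\<lambda>i. u i / c) x = ip n u x / c" "ip n x (\<lambda>i. u i / c) = ip n x u / c"
  by (simp_all add: ip_def sum_divide_distrib)

lemma ip_self_nonneg: "0 \<le> ip n u u"
  by (simp add: ip_def sum_nonneg)

lemma vnorm_power2: "vnorm n u ^ 2 = ip n u u"
  by (simp add: vnorm_def ip_self_nonneg)

lemma vnorm_nonneg: "0 \<le> vnorm n u"
  by (simp add: vnorm_def ip_self_nonneg)

text \<open>\<open>gs_cols\<close> grows only at its end, so position \<open>l\<close> of the
  shortest list that has it gives the vector for all lengths, and induction on \<open>l\<close>
  becomes possible.\<close>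

definition gvec :: "nat \<Rightarrow> (nat \<times> nat \<Rightarrow> real) \<Rightarrow> nat \<Rightarrow> nat \<Rightarrow> real" where
  "gvec n Y l = gs_cols n Y (Suc l) ! l"

definition wvec :: "nat \<Rightarrow> (nat \<times> nat \<Rightarrow> real) \<Rightarrow> nat \<Rightarrow> nat \<Rightarrow> real" where
  "wvec n Y l = (\<lambda>i. col Y l i - (\<Sum>m<l. ip n (col Y l) (gvec n Y m) * gvec n Y m i))"

text \<open>The squared length of the projection of column \<open>j\<close> onto the span of the
  preceding vectors \<open>gvec\<close>.\<close>

definition proj2 :: "nat \<Rightarrow> (nat \<times> nat \<Rightarrow> real) \<Rightarrow> nat \<Rightarrow> real" where
  "proj2 n Y j = (\<Sum>l<j. (ip n (col Y j) (gvec n Y l))\<^sup>2)"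

lemma length_gs_cols: "length (gs_cols n Y k) = k"
  by (induction k) (simp_all add: Let_def)

lemma gs_cols_nth: "l < k \<Longrightarrow> gs_cols n Y k ! l = gvec n Y l"
proof (induction k)
  case (Suc k)
  show ?case
  proof (cases "l = k")
    case False
    then show ?thesis
      using Suc by (simp add: Let_def nth_append length_gs_cols)
  qed (simp only: gvec_def)
qed simp

lemma gvec_eq: "gvec n Y l = (\<lambda>i. wvec n Y l i / vnorm n (wvec n Y l))"
proof -
  have *: "(\<Sum>g\<leftarrow>gs_cols n Y l. ip n (col Y l) g * g i)
      = (\<Sum>m<l. ip n (col Y l) (gvec n Y m) * gvec n Y m i)" for i
    by (simp add: sum_list_sum_nth length_gs_cols gs_cols_nth atLeast0LessThan)
  show ?thesis
    unfolding gvec_def[of n Y l] wvec_def *[symmetric]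
    by (simp add: Let_def nth_append length_gs_cols)
qed

lemma gamma_eq_gvec: "j < n \<Longrightarrow> gamma n Y i j = gvec n Y j i"
  by (simp add: gamma_def gs_cols_nth)

lemma measurable_gvec [measurable]:
  "i < n \<Longrightarrow> l < n \<Longrightarrow> (\<lambda>Y. gvec n Y l i) \<in> borel_measurable (gauss_matrix n)"
proof (induction l arbitrary: i rule: less_induct)
  case (less l)
  have [measurable]: "(\<lambda>Y. wvec n Y l i) \<in> borel_measurable (gauss_matrix n)" if "i < n" for i
    unfolding wvec_def ip_def col_def using less.prems that
    by (auto intro!: borel_measurable_diff borel_measurable_sum borel_measurable_times less.IH)
  show ?case
    unfolding gvec_eq vnorm_def ip_def using less.prems by measurable
qed

text \<open>Gram-Schmidt never looks ahead. This is what makes \<open>gvec n Y l\<close> independent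
  of every column \<open>j > l\<close>.\<close>

lemma gvec_cong:
  assumes "\<And>i c. i < n \<Longrightarrow> c \<le> l \<Longrightarrow> Y (i, c) = Y' (i, c)" and "i < n"
  shows "gvec n Y l i = gvec n Y' l i"
  using assms
proof (induction l arbitrary: i rule: less_induct)
  case (less l)
  have w: "wvec n Y l i = wvec n Y' l i" if "i < n" for i
    unfolding wvec_def using less that
    by (intro arg_cong2[where f="(-)"] sum.cong arg_cong2[where f="(*)"] ip_cong) (auto simp: col_def)
  show ?case
    using w less.prems by (simp add: gvec_eq vnorm_def cong: ip_cong)
qed

lemma ip_reflect:
  assumes "\<alpha>\<^sup>2 + \<beta>\<^sup>2 = 1" "i < n" "k < n" "i \<noteq> k"
  shows "ip n (reflect i k \<alpha> \<beta> u) (reflect i k \<alpha> \<beta> v) = ip n u v"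
proof -
  have split: "(\<Sum>r<n. g r) = g i + g k + (\<Sum>r\<in>{..<n} - {i} - {k}. g r)" for g :: "nat \<Rightarrow> real"
    using assms by (subst sum.remove[of _ i]) (auto simp: sum.remove[of "{..<n} - {i}" k])
  have "(\<alpha> * u i + \<beta> * u k) * (\<alpha> * v i + \<beta> * v k) + (\<beta> * u i - \<alpha> * u k) * (\<beta> * v i - \<alpha> * v k)
      = (\<alpha>\<^sup>2 + \<beta>\<^sup>2) * (u i * v i + u k * v k)"
    by (simp add: power2_eq_square algebra_simps)
  then show ?thesis
    using assms unfolding ip_def split by (simp add: reflect_def)
qed

lemma reflect_diff_sum:
  "reflect i k \<alpha> \<beta> (\<lambda>r. u r - (\<Sum>m\<in>A. c m * v m r))
    = (\<lambda>r. reflect i k \<alpha> \<beta> u r - (\<Sum>m\<in>A. c m * reflect i k \<alpha> \<beta> (v m) r))"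
  by (auto simp: reflect_def fun_eq_iff algebra_simps sum_distrib_left sum.distrib sum_subtractf)

lemma reflect_divide: "reflect i k \<alpha> \<beta> (\<lambda>r. u r / c) = (\<lambda>r. reflect i k \<alpha> \<beta> u r / c)"
  by (auto simp: reflect_def fun_eq_iff add_divide_distrib diff_divide_distrib)

text \<open>Each step is built from linear combinations and inner products, both compatible with an
  orthogonal map applied to all columns at once.\<close>

lemma gvec_reflect_rows:
  assumes ab: "\<alpha>\<^sup>2 + \<beta>\<^sup>2 = 1" "i < n" "k < n" "i \<noteq> k" and "l < n"
  shows "gvec n (reflect_rows i k \<alpha> \<beta> {..<n} Y) l = reflect i k \<alpha> \<beta> (gvec n Y l)"
  using \<open>l < n\<close>
proof (induction l rule: less_induct)
  case (less l)
  have col: "col (reflect_rows i k \<alpha> \<beta> {..<n} Y) l = reflect i k \<alpha> \<beta> (col Y l)"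
    using less.prems by (simp add: reflect_rows_def col_def)
  have "wvec n (reflect_rows i k \<alpha> \<beta> {..<n} Y) l = reflect i k \<alpha> \<beta> (wvec n Y l)"
    unfolding wvec_def reflect_diff_sum col using less by (simp add: ip_reflect[OF ab])
  then show ?case
    unfolding gvec_eq reflect_divide by (simp add: vnorm_def ip_reflect[OF ab])
qed

text \<open>A vanishing \<open>wvec\<close> is divided by 0, which gives the zero vector instead of
  a unit vector.\<close>

lemma ip_gvec_self: "ip n (gvec n Y l) (gvec n Y l) = (if vnorm n (wvec n Y l) = 0 then 0 else 1)"
  by (auto simp: gvec_eq ip_divide vnorm_power2[symmetric] power2_eq_square)

text \<open>If \<open>gvec\<close> is 0, both sides vanish; otherwise its norm is 1. This form of
  normalization covers dependent columns as well.\<close>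

lemma ip_self_gvec_mult: "ip n u (gvec n Y l) * ip n (gvec n Y l) (gvec n Y l) = ip n u (gvec n Y l)"
  by (auto simp: ip_gvec_self) (simp add: gvec_eq ip_def)

text \<open>Orthogonality of the earlier vectors is a premise so that the lemma can be applied
  inside the induction that establishes it.\<close>

lemma ip_wvec_eq_0:
  assumes "\<And>m m'. m < l \<Longrightarrow> m' < l \<Longrightarrow> m \<noteq> m' \<Longrightarrow> ip n (gvec n Y m) (gvec n Y m') = 0" and "m < l"
  shows "ip n (wvec n Y l) (gvec n Y m) = 0"
proof -
  have "(\<Sum>m'<l. ip n (col Y l) (gvec n Y m') * ip n (gvec n Y m') (gvec n Y m))
      = ip n (col Y l) (gvec n Y m) * ip n (gvec n Y m) (gvec n Y m)"
    using assms by (subst sum.remove[of _ m]) (auto intro!: sum.neutral)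
  then show ?thesis
    unfolding wvec_def ip_diff_sum_left by (simp add: ip_self_gvec_mult)
qed

lemma ip_gvec_orthogonal_less: "m < l \<Longrightarrow> ip n (gvec n Y l) (gvec n Y m) = 0"
proof (induction l arbitrary: m rule: less_induct)
  case (less l)
  have "ip n (wvec n Y l) (gvec n Y m) = 0"
    using less.prems less.IH by (intro ip_wvec_eq_0) (metis ip_commute nat_neq_iff)+
  then show ?case
    by (subst gvec_eq) (simp add: ip_divide)
qed

lemma ip_gvec_orthogonal: "l \<noteq> m \<Longrightarrow> ip n (gvec n Y l) (gvec n Y m) = 0"
  by (metis ip_commute ip_gvec_orthogonal_less nat_neq_iff)

lemma ip_wvec_col: "ip n (wvec n Y j) (col Y j) = ip n (col Y j) (col Y j) - proj2 n Y j"
  unfolding wvec_def ip_diff_sum_left proj2_def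
  by (simp add: power2_eq_square ip_commute[of n "gvec n Y _" "col Y j"])

text \<open>Pythagoras: \<open>wvec\<close> is orthogonal to the projection that was
  subtracted.\<close>

lemma ip_wvec_self: "ip n (wvec n Y j) (wvec n Y j) = ip n (col Y j) (col Y j) - proj2 n Y j"
proof -
  have "ip n (wvec n Y j) (wvec n Y j) = ip n (col Y j) (wvec n Y j)
      - (\<Sum>m<j. ip n (col Y j) (gvec n Y m) * ip n (gvec n Y m) (wvec n Y j))"
    by (subst (1) wvec_def) (rule ip_diff_sum_left)
  also have "(\<Sum>m<j. ip n (col Y j) (gvec n Y m) * ip n (gvec n Y m) (wvec n Y j)) = 0"
    by (intro sum.neutral) (auto simp: ip_commute[of n "gvec n Y _" "wvec n Y j"] intro!: ip_wvec_eq_0 ip_gvec_orthogonal)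
  finally show ?thesis
    using ip_wvec_col[of n Y j] by (simp add: ip_commute)
qed

section \<open>Distance of a single column: exact formula and pointwise bounds\<close>

definition coldist :: "nat \<Rightarrow> (nat \<times> nat \<Rightarrow> real) \<Rightarrow> nat \<Rightarrow> real" where
  "coldist n Y j = (\<Sum>i<n. (sqrt (real n) * gvec n Y j i - Y (i, j))\<^sup>2)"

text \<open>Expand the square. The inner product of \<open>gvec\<close> and \<open>col\<close> is
  the norm of \<open>wvec\<close>, because \<open>wvec\<close> and \<open>col\<close> differ by a
  vector orthogonal to \<open>wvec\<close>. The last summand accounts for the case
  \<open>gvec = 0\<close>.\<close>

lemma coldist_eq:
  "coldist n Y j = real n - 2 * sqrt (real n) * vnorm n (wvec n Y j) + ip n (col Y j) (col Y j)
    - (if vnorm n (wvec n Y j) = 0 then real n else 0)"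
proof -
  have "(\<Sum>i<n. (s * u i - v i)\<^sup>2) = s\<^sup>2 * ip n u u - 2 * s * ip n u v + ip n v v" for s u v
  proof -
    have "(s * u i - v i)\<^sup>2 = s\<^sup>2 * (u i * u i) - 2 * s * (u i * v i) + v i * v i" for i
      by (simp add: power2_eq_square algebra_simps)
    then show ?thesis
      by (simp add: ip_def sum.distrib sum_subtractf sum_distrib_left)
  qed
  from this[of "sqrt (real n)" "gvec n Y j" "col Y j"]
  have "coldist n Y j = real n * ip n (gvec n Y j) (gvec n Y j)
      - 2 * sqrt (real n) * ip n (gvec n Y j) (col Y j) + ip n (col Y j) (col Y j)"
    by (simp add: coldist_def col_def)
  moreover have "ip n (gvec n Y j) (col Y j) = vnorm n (wvec n Y j)"
  proof -
    have "ip n (wvec n Y j) (col Y j) = vnorm n (wvec n Y j) * vnorm n (wvec n Y j)"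
      using vnorm_power2[of n "wvec n Y j"] by (simp add: ip_wvec_col ip_wvec_self power2_eq_square)
    then show ?thesis by (simp add: gvec_eq ip_divide)
  qed
  ultimately show ?thesis
    by (simp add: ip_gvec_self)
qed

lemma proj2_nonneg: "0 \<le> proj2 n Y j"
  by (simp add: proj2_def sum_nonneg)

lemma coldist_nonneg: "0 \<le> coldist n Y j"
  by (simp add: coldist_def sum_nonneg)

text \<open>With w, y, s for the norms of \<open>wvec\<close> and \<open>col\<close> and for sqrt n,
  the distance is at most \<open>(w - s)^2 + proj2\<close>. The numbers w and s are compared through
  y, and squares of differences are bounded by differences of squares, whose moments are
  accessible.\<close>

lemma coldist_le:
  assumes n: "0 < n"
  shows "coldist n Y j \<le> 2 * (ip n (col Y j) (col Y j) - real n)\<^sup>2 / real n + 3 * proj2 n Y j"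
proof -
  define w where "w = vnorm n (wvec n Y j)"
  define y where "y = vnorm n (col Y j)"
  define s where "s = sqrt (real n)"
  have w2: "w\<^sup>2 = y\<^sup>2 - proj2 n Y j"
    by (simp add: w_def y_def vnorm_power2 ip_wvec_self)
  have nn: "0 \<le> w" "0 \<le> y" "0 < s" and s2: "s\<^sup>2 = real n"
    using n by (auto simp: w_def y_def s_def vnorm_nonneg)
  have "w \<le> y"
    using w2 proj2_nonneg[of n Y j] nn by (auto intro: power2_le_imp_le)
  then have "(y - w) * (y - w) \<le> (y - w) * (y + w)"
    using nn by (intro mult_left_mono) auto
  then have yw: "(y - w)\<^sup>2 \<le> proj2 n Y j"
    using w2 by (simp add: power2_eq_square algebra_simps)
  have "(y - s)\<^sup>2 * s\<^sup>2 \<le> (y - s)\<^sup>2 * (y + s)\<^sup>2"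
    using nn by (intro mult_left_mono power_mono) auto
  also have "\<dots> = (y\<^sup>2 - s\<^sup>2)\<^sup>2"
    by (simp add: power2_eq_square algebra_simps)
  finally have ys: "(y - s)\<^sup>2 \<le> (y\<^sup>2 - real n)\<^sup>2 / real n"
    using n by (simp add: s2 field_simps)
  \<comment> \<open>Parallelogram law for \<open>y - s\<close> and \<open>y - w\<close>.\<close>
  have "0 \<le> (2 * y - w - s)\<^sup>2" by simp
  then have "(w - s)\<^sup>2 \<le> 2 * (y - s)\<^sup>2 + 2 * (y - w)\<^sup>2"
    by (simp add: power2_eq_square algebra_simps)
  moreover have "coldist n Y j \<le> (w - s)\<^sup>2 + proj2 n Y j"
    using w2 by (simp add: coldist_eq w_def[symmetric] s_def[symmetric] vnorm_power2[symmetric]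
        y_def[symmetric] power2_diff s2)
  ultimately show ?thesis
    using yw ys by (simp add: vnorm_power2[symmetric] y_def[symmetric])
qed

text \<open>The right-hand side is the Taylor polynomial of \<open>sqrt\<close> at 1.\<close>

lemma sqrt_le_cubic:
  fixes x :: real
  assumes "0 \<le> x"
  shows "sqrt x \<le> 1 + (x - 1) / 2 - (x - 1)\<^sup>2 / 8 + (x - 1) ^ 3 / 16"
proof -
  define s where "s = sqrt x"
  have s: "0 \<le> s" "x = s\<^sup>2" using assms by (auto simp: s_def)
  define P where "P = 1 + (x - 1) / 2 - (x - 1)\<^sup>2 / 8 + (x - 1) ^ 3 / 16"
  \<comment> \<open>Third-order contact at 1 leaves a zero of order four, an even power, with a
    positive cofactor.\<close>
  have "16 * (P - s) = (s - 1) ^ 4 * (s\<^sup>2 + 4 * s + 5)"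
    unfolding P_def s by (simp add: field_simps eval_nat_numeral)
  also have "0 \<le> \<dots>"
    using s by (intro mult_nonneg_nonneg) auto
  finally show ?thesis
    unfolding s_def[symmetric] P_def[symmetric] by simp
qed

text \<open>\<open>sqrt_le_cubic\<close> is applied to the squared norm of \<open>wvec\<close>
  divided by \<open>n\<close>. The product of \<open>A\<close> and \<open>proj2\<close> is split by
  AM-GM with a free weight \<open>c\<close>, so that only separate moments of the two occur.\<close>

lemma coldist_ge:
  fixes Y :: "nat \<times> nat \<Rightarrow> real" and j :: nat and c :: real
  assumes n: "0 < n" and c: "0 < c"
  defines "A \<equiv> ip n (col Y j) (col Y j) - real n"
  shows "coldist n Y j \<ge> proj2 n Y j + A\<^sup>2 / (4 * real n)
      - (c * A\<^sup>2 + (proj2 n Y j)\<^sup>2 / c) / (4 * real n) - A ^ 3 / (8 * real n ^ 2)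
      - (if vnorm n (wvec n Y j) = 0 then real n else 0)"
proof -
  define a where "a = A"
  define b where "b = proj2 n Y j"
  define N where "N = real n"
  have N: "0 < N" using n by (simp add: N_def)
  have b: "0 \<le> b" by (simp add: b_def proj2_nonneg)
  define x where "x = 1 + (a - b) / N"
  have xN: "x * N = ip n (wvec n Y j) (wvec n Y j)"
    using N by (simp add: x_def ip_wvec_self a_def b_def A_def N_def field_simps)
  then have x0: "0 \<le> x"
    using N ip_self_nonneg[of n "wvec n Y j"] by (metis mult_neg_pos not_less)
  have "vnorm n (wvec n Y j) = sqrt x * sqrt N"
    by (simp add: vnorm_def xN[symmetric] real_sqrt_mult)
  then have "2 * sqrt N * vnorm n (wvec n Y j) = 2 * N * sqrt x"
    using N by simp
  also have "\<dots> \<le> 2 * N * (1 + (x - 1) / 2 - (x - 1)\<^sup>2 / 8 + (x - 1) ^ 3 / 16)"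
    using sqrt_le_cubic[OF x0] N by (intro mult_left_mono) auto
  also have "\<dots> = 2 * N + (a - b) - (a - b)\<^sup>2 / (4 * N) + (a - b) ^ 3 / (8 * N\<^sup>2)"
    using N by (simp add: x_def field_simps eval_nat_numeral)
  finally have 1: "2 * sqrt N * vnorm n (wvec n Y j)
      \<le> 2 * N + (a - b) - (a - b)\<^sup>2 / (4 * N) + (a - b) ^ 3 / (8 * N\<^sup>2)" .
  \<comment> \<open>As \<open>b\<close> is nonnegative and cubing is monotone, the mixed cubic terms
    disappear.\<close>
  have 2: "(a - b) ^ 3 / (8 * N\<^sup>2) \<le> a ^ 3 / (8 * N\<^sup>2)"
    using b N by (intro divide_right_mono power_mono_odd) auto
  \<comment> \<open>AM-GM for \<open>2 * a * b\<close>; afterwards the term \<open>b^2\<close> of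
    \<open>(a - b)^2\<close> is dropped.\<close>
  have "0 \<le> (c * a - b)\<^sup>2 / c"
    using c by simp
  also have "\<dots> = c * a\<^sup>2 + b\<^sup>2 / c - 2 * a * b"
    using c by (simp add: field_simps power2_eq_square)
  finally have "a\<^sup>2 - (c * a\<^sup>2 + b\<^sup>2 / c) \<le> (a - b)\<^sup>2"
    by (simp add: power2_diff) (smt (verit) zero_le_power2)
  then have 3: "(a\<^sup>2 - (c * a\<^sup>2 + b\<^sup>2 / c)) / (4 * N) \<le> (a - b)\<^sup>2 / (4 * N)"
    using N by (intro divide_right_mono) auto
  have "coldist n Y j = N - 2 * sqrt N * vnorm n (wvec n Y j) + (N + a)
    - (if vnorm n (wvec n Y j) = 0 then real n else 0)"
    by (simp add: coldist_eq N_def a_def A_def)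
  then show ?thesis
    using 1 2 3 unfolding a_def[symmetric] b_def[symmetric] N_def[symmetric]
    by (simp add: diff_divide_distrib)
qed

text \<open>Junk value: \<open>gvec\<close> is 0 when \<open>wvec\<close> vanishes. A bound of order \<open>(1 + j\<^sup>2) / n\<^sup>2\<close> on the probability of
  this event suffices and makes an almost sure linear independence argument unnecessary.\<close>

lemma wvec_eq_0_indicator_le:
  assumes n: "0 < n"
  shows "(if vnorm n (wvec n Y j) = 0 then 1 else 0)
    \<le> 16 * (ip n (col Y j) (col Y j) - real n) ^ 4 / real n ^ 4 + 4 * (proj2 n Y j)\<^sup>2 / real n ^ 2"
proof (cases "vnorm n (wvec n Y j) = 0")
  case True
  define a where "a = ip n (col Y j) (col Y j) - real n"
  define b where "b = proj2 n Y j"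
  have "b = real n + a"
    using True vnorm_power2[of n "wvec n Y j"] by (simp add: a_def b_def ip_wvec_self)
  \<comment> \<open>Since \<open>b\<close> and \<open>a\<close> differ by \<open>n\<close>, one of
    them has size at least \<open>n / 2\<close>; each case yields one term of the bound.\<close>
  then consider "real n / 2 \<le> \<bar>a\<bar>" | "real n / 2 \<le> b" by linarith
  then have "1 \<le> 16 * a ^ 4 / real n ^ 4 + 4 * b\<^sup>2 / real n ^ 2"
  proof cases
    case 1
    then have "(real n / 2) ^ 4 \<le> \<bar>a\<bar> ^ 4" by (intro power_mono) auto
    then have "1 \<le> 16 * a ^ 4 / real n ^ 4" using n by (simp add: field_simps)
    then show ?thesis by (smt (verit) divide_nonneg_nonneg zero_le_power2 mult_nonneg_nonneg)
  next
    case 2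
    then have "(real n / 2) ^ 2 \<le> b ^ 2" by (intro power_mono) auto
    then have "1 \<le> 4 * b\<^sup>2 / real n ^ 2" using n by (simp add: field_simps)
    moreover have "0 \<le> 16 * a ^ 4 / real n ^ 4" by simp
    ultimately show ?thesis by linarith
  qed
  then show ?thesis using True by (simp add: a_def b_def)
qed simp

section \<open>Moments of the column distances\<close>

abbreviation coldev :: "nat \<Rightarrow> (nat \<times> nat \<Rightarrow> real) \<Rightarrow> nat \<Rightarrow> real" where
  "coldev n Y j \<equiv> ip n (col Y j) (col Y j) - real n"

abbreviation degenerate :: "nat \<Rightarrow> (nat \<times> nat \<Rightarrow> real) \<Rightarrow> nat \<Rightarrow> real" where
  "degenerate n Y j \<equiv> (if vnorm n (wvec n Y j) = 0 then 1 else 0)"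

lemma prob_space_gauss_matrix: "prob_space (gauss_matrix n)"
  unfolding gauss_matrix_def by (intro prob_space_PiM prob_space_std_gauss)

lemma measurable_ip_col_gvec [measurable]:
  "l < n \<Longrightarrow> j < n \<Longrightarrow> (\<lambda>Y. ip n (col Y j) (gvec n Y l)) \<in> borel_measurable (gauss_matrix n)"
  unfolding ip_def col_def by measurable

lemma measurable_ip_col_col [measurable]:
  "j < n \<Longrightarrow> (\<lambda>Y. ip n (col Y j) (col Y j)) \<in> borel_measurable (gauss_matrix n)"
  unfolding ip_def col_def by measurable

lemma measurable_proj2 [measurable]:
  "j < n \<Longrightarrow> (\<lambda>Y. proj2 n Y j) \<in> borel_measurable (gauss_matrix n)"
  unfolding proj2_def by (auto intro!: borel_measurable_sum borel_measurable_power measurable_ip_col_gvec)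

lemma measurable_vnorm_wvec [measurable]:
  "j < n \<Longrightarrow> (\<lambda>Y. vnorm n (wvec n Y j)) \<in> borel_measurable (gauss_matrix n)"
  unfolding vnorm_def ip_wvec_self by measurable

lemma measurable_coldist [measurable]:
  "j < n \<Longrightarrow> (\<lambda>Y. coldist n Y j) \<in> borel_measurable (gauss_matrix n)"
  unfolding coldist_def by measurable

text \<open>Fubini with column \<open>j\<close> innermost: whatever is built from the other columns
  is constant in the inner integral.\<close>

lemma nn_integral_column:
  assumes j: "j < n" and F: "F \<in> borel_measurable (gauss_matrix n)"
  defines "I \<equiv> {..<n} \<times> ({..<n} - {j})" and "J \<equiv> {..<n} \<times> {j}"
  shows "(\<integral>\<^sup>+Y. F Y \<partial>gauss_matrix n)
    = (\<integral>\<^sup>+x. \<integral>\<^sup>+y. F (merge I J (x, y)) \<partial>PiM J (\<lambda>_. std_gauss) \<partial>PiM I (\<lambda>_. std_gauss))"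
proof -
  interpret prob_space std_gauss by (rule prob_space_std_gauss)
  interpret product_sigma_finite "\<lambda>_. std_gauss" by standard
  have "I \<union> J = {..<n} \<times> {..<n}" "I \<inter> J = {}" "finite I" "finite J"
    using j by (auto simp: I_def J_def)
  then show ?thesis
    using F product_nn_integral_fold[of I J F] by (simp add: gauss_matrix_def)
qed

lemma sum_column: "(\<Sum>p\<in>A \<times> {j}. f p) = (\<Sum>i\<in>A. f (i, j))"
  using sum.cartesian_product[of "\<lambda>a b. f (a, b)" "{j}" A] by simp

text \<open>The fourth cumulants \<open>3 * g^4 - 3 * (g^2)^2\<close> of the summands vanish, which
  leaves the moments of a centred Gaussian law of variance \<open>ip n g g\<close>.\<close>

lemma has_moments_column_functional:
  fixes j :: nat
  shows "has_moments (PiM ({..<n} \<times> {j}) (\<lambda>_. std_gauss)) (\<lambda>y. \<Sum>i<n. y (i, j) * g i)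
    (ip n g g) 0 (3 * (ip n g g)\<^sup>2)"
proof -
  have "has_moments (PiM ({..<n} \<times> {j}) (\<lambda>_. std_gauss)) (\<lambda>y. \<Sum>p\<in>{..<n} \<times> {j}. g (fst p) * y p)
     (\<Sum>p\<in>{..<n} \<times> {j}. (g (fst p))\<^sup>2) (\<Sum>p\<in>{..<n} \<times> {j}. 0)
     ((\<Sum>p\<in>{..<n} \<times> {j}. 3 * g (fst p) ^ 4 - 3 * ((g (fst p))\<^sup>2)\<^sup>2) + 3 * (\<Sum>p\<in>{..<n} \<times> {j}. (g (fst p))\<^sup>2)\<^sup>2)"
    by (rule has_moments_PiM_sum) (auto intro: prob_space_std_gauss has_moments_linear)
  then show ?thesis
    by (simp add: sum_column ip_def mult.commute flip: power2_eq_square power_mult)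
qed

text \<open>A centred chi-square law with \<open>n\<close> degrees of freedom; each entry
  contributes the fourth cumulant \<open>60 - 3 * 2^2 = 48\<close>.\<close>

lemma has_moments_coldev:
  assumes j: "j < n"
  shows "has_moments (gauss_matrix n) (\<lambda>Y. coldev n Y j) (2 * real n) (8 * real n) (12 * real n ^ 2 + 48 * real n)"
proof -
  have "has_moments (gauss_matrix n) (\<lambda>Y. \<Sum>p\<in>{..<n} \<times> {j}. (Y p)\<^sup>2 - 1)
     (\<Sum>p\<in>{..<n} \<times> {j}. 2) (\<Sum>p\<in>{..<n} \<times> {j}. 8)
     ((\<Sum>p\<in>{..<n} \<times> {j}. 60 - 3 * 2\<^sup>2) + 3 * (\<Sum>p\<in>{..<n} \<times> {j}. 2)\<^sup>2)"
    unfolding gauss_matrix_def using j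
    by (intro has_moments_PiM_sum) (auto intro: prob_space_std_gauss has_moments_square)
  then show ?thesis
    by (simp add: sum_column ip_def col_def power2_eq_square sum_subtractf algebra_simps)
qed

text \<open>With all columns but \<open>j\<close> frozen, \<open>gvec n Y l\<close> is a fixed
  vector while column \<open>j\<close> is still standard Gaussian. Integrability is read off
  afterwards from these nonnegative integrals.\<close>

lemma nn_integral_column_functional:
  assumes lj: "l < j" "j < n"
  shows "(\<integral>\<^sup>+Y. ennreal ((ip n (col Y j) (gvec n Y l)) ^ 2) \<partial>gauss_matrix n)
      = (\<integral>\<^sup>+Y. ennreal (ip n (gvec n Y l) (gvec n Y l)) \<partial>gauss_matrix n)"
    and "(\<integral>\<^sup>+Y. ennreal ((ip n (col Y j) (gvec n Y l)) ^ 4) \<partial>gauss_matrix n) \<le> 3"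
proof -
  define I where "I = {..<n} \<times> ({..<n} - {j})"
  define J where "J = {..<n} \<times> {j}"
  let ?I = "PiM I (\<lambda>_. std_gauss)" and ?J = "PiM J (\<lambda>_. std_gauss)"
  interpret I: prob_space ?I by (intro prob_space_PiM prob_space_std_gauss)
  interpret J: prob_space ?J by (intro prob_space_PiM prob_space_std_gauss)
  \<comment> \<open>Overwriting column \<open>j\<close> leaves \<open>gvec\<close> at
    \<open>l\<close> unchanged because \<open>l < j\<close>.\<close>
  have g: "gvec n (merge I J (x, y)) l i = gvec n x l i" if "i < n" for x y i
    using that lj by (intro gvec_cong) (auto simp: merge_def I_def)
  have ip: "ip n (col (merge I J (x, y)) j) (gvec n (merge I J (x, y)) l)
      = (\<Sum>i<n. y (i, j) * gvec n x l i)" for x y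
    unfolding ip_def using g lj by (intro sum.cong) (auto simp: merge_def I_def J_def col_def)
  have ipg: "ip n (gvec n (merge I J (x, y)) l) (gvec n (merge I J (x, y)) l)
      = ip n (gvec n x l) (gvec n x l)" for x y
    using g by (intro ip_cong) auto
  have mom: "(\<integral>\<^sup>+y. ennreal ((\<Sum>i<n. y (i, j) * gvec n x l i) ^ 2) \<partial>?J) = ennreal (ip n (gvec n x l) (gvec n x l))"
    "(\<integral>\<^sup>+y. ennreal ((\<Sum>i<n. y (i, j) * gvec n x l i) ^ 4) \<partial>?J) = ennreal (3 * (ip n (gvec n x l) (gvec n x l))\<^sup>2)" for x
    using has_moments_column_functional[of n j "gvec n x l"]
    by (subst nn_integral_eq_integral; force simp: has_moments_def has_bochner_integral_iff J_def)+
  have [measurable]: "(\<lambda>Y. ip n (gvec n Y l) (gvec n Y l)) \<in> borel_measurable (gauss_matrix n)"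
    unfolding ip_def using lj by (auto intro!: borel_measurable_sum borel_measurable_times measurable_gvec)
  have [measurable]: "(\<lambda>Y. ip n (col Y j) (gvec n Y l)) \<in> borel_measurable (gauss_matrix n)"
    using lj by (auto intro!: measurable_ip_col_gvec)
  note fold = nn_integral_column[OF \<open>j < n\<close>, folded I_def J_def]
  show "(\<integral>\<^sup>+Y. ennreal ((ip n (col Y j) (gvec n Y l)) ^ 2) \<partial>gauss_matrix n)
      = (\<integral>\<^sup>+Y. ennreal (ip n (gvec n Y l) (gvec n Y l)) \<partial>gauss_matrix n)"
    by (subst (1 2) fold) (simp_all add: ip ipg mom J.emeasure_space_1)
  have "(\<integral>\<^sup>+Y. ennreal ((ip n (col Y j) (gvec n Y l)) ^ 4) \<partial>gauss_matrix n)
    = (\<integral>\<^sup>+x. ennreal (3 * (ip n (gvec n x l) (gvec n x l))\<^sup>2) \<partial>?I)"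
    by (subst fold) (simp_all add: ip mom)
  also have "\<dots> \<le> (\<integral>\<^sup>+x. 3 \<partial>?I)"
    by (intro nn_integral_mono) (simp add: ip_gvec_self)
  finally show "(\<integral>\<^sup>+Y. ennreal ((ip n (col Y j) (gvec n Y l)) ^ 4) \<partial>gauss_matrix n) \<le> 3"
    by (simp add: I.emeasure_space_1)
qed

lemma integrable_degenerate:
  assumes "l < n"
  shows "integrable (gauss_matrix n) (\<lambda>Y. degenerate n Y l)"
proof -
  interpret prob_space "gauss_matrix n" by (rule prob_space_gauss_matrix)
  show ?thesis using assms by (intro integrable_const_bound[of _ 1]) auto
qed

text \<open>The squared norm of \<open>gvec n Y l\<close> is 1 or 0, so the second moment is the
  probability that \<open>wvec n Y l\<close> does not vanish.\<close>

lemma column_functional_moments: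
  assumes lj: "l < j" "j < n"
  shows "integrable (gauss_matrix n) (\<lambda>Y. (ip n (col Y j) (gvec n Y l)) ^ 2)"
    and "(\<integral>Y. (ip n (col Y j) (gvec n Y l)) ^ 2 \<partial>gauss_matrix n) = 1 - (\<integral>Y. degenerate n Y l \<partial>gauss_matrix n)"
    and "integrable (gauss_matrix n) (\<lambda>Y. (ip n (col Y j) (gvec n Y l)) ^ 4)"
    and "(\<integral>Y. (ip n (col Y j) (gvec n Y l)) ^ 4 \<partial>gauss_matrix n) \<le> 3"
proof -
  interpret prob_space "gauss_matrix n" by (rule prob_space_gauss_matrix)
  have [measurable]: "(\<lambda>Y. ip n (col Y j) (gvec n Y l)) \<in> borel_measurable (gauss_matrix n)"
    "(\<lambda>Y. vnorm n (wvec n Y l)) \<in> borel_measurable (gauss_matrix n)"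
    using lj by (auto intro!: measurable_ip_col_gvec measurable_vnorm_wvec)
  have int: "integrable (gauss_matrix n) (\<lambda>Y. degenerate n Y l)"
    using lj by (intro integrable_degenerate) auto
  have e: "(\<integral>\<^sup>+Y. ennreal (ip n (gvec n Y l) (gvec n Y l)) \<partial>gauss_matrix n)
      = ennreal (1 - (\<integral>Y. degenerate n Y l \<partial>gauss_matrix n))"
  proof -
    have eq: "ip n (gvec n Y l) (gvec n Y l) = 1 - degenerate n Y l" for Y
      by (simp add: ip_gvec_self)
    have "(\<integral>\<^sup>+Y. ennreal (1 - degenerate n Y l) \<partial>gauss_matrix n) = ennreal (\<integral>Y. 1 - degenerate n Y l \<partial>gauss_matrix n)"
      using int by (intro nn_integral_eq_integral) auto
    then show ?thesis
      unfolding eq using int by (simp add: prob_space)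
  qed
  \<comment> \<open>Needed to leave \<open>ennreal\<close>, which truncates negative reals to
    0.\<close>
  have le1: "(\<integral>Y. degenerate n Y l \<partial>gauss_matrix n) \<le> 1"
    using int by (intro integral_le_const) auto
  note nn = nn_integral_column_functional[OF lj]
  show "integrable (gauss_matrix n) (\<lambda>Y. (ip n (col Y j) (gvec n Y l)) ^ 2)"
    by (rule integrableI_nonneg) (auto simp: nn e)
  show "(\<integral>Y. (ip n (col Y j) (gvec n Y l)) ^ 2 \<partial>gauss_matrix n) = 1 - (\<integral>Y. degenerate n Y l \<partial>gauss_matrix n)"
    using le1 by (subst integral_eq_nn_integral) (auto simp: nn e)
  show "integrable (gauss_matrix n) (\<lambda>Y. (ip n (col Y j) (gvec n Y l)) ^ 4)"
    using nn(2) by (intro integrableI_nonneg) (auto simp: order_le_less_trans)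
  show "(\<integral>Y. (ip n (col Y j) (gvec n Y l)) ^ 4 \<partial>gauss_matrix n) \<le> 3"
    using enn2real_mono[OF nn(2)] by (subst integral_eq_nn_integral) auto
qed

lemma proj2_moments:
  assumes j: "j < n"
  shows "integrable (gauss_matrix n) (\<lambda>Y. proj2 n Y j)"
    and "(\<integral>Y. proj2 n Y j \<partial>gauss_matrix n) = real j - (\<Sum>l<j. \<integral>Y. degenerate n Y l \<partial>gauss_matrix n)"
    and "integrable (gauss_matrix n) (\<lambda>Y. (proj2 n Y j)\<^sup>2)"
    and "(\<integral>Y. (proj2 n Y j)\<^sup>2 \<partial>gauss_matrix n) \<le> 3 * real j ^ 2"
proof -
  note mom = column_functional_moments[OF _ j]
  show "integrable (gauss_matrix n) (\<lambda>Y. proj2 n Y j)"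
    unfolding proj2_def using mom(1) by (intro Bochner_Integration.integrable_sum) auto
  show "(\<integral>Y. proj2 n Y j \<partial>gauss_matrix n) = real j - (\<Sum>l<j. \<integral>Y. degenerate n Y l \<partial>gauss_matrix n)"
    unfolding proj2_def using mom(1,2) by (subst Bochner_Integration.integral_sum) (auto simp: sum_subtractf)
  \<comment> \<open>Cauchy-Schwarz: the square of a sum of \<open>j\<close> terms is at most
    \<open>j\<close> times the sum of their squares.\<close>
  define S where "S Y = (\<Sum>l<j. (ip n (col Y j) (gvec n Y l)) ^ 4) * real j" for Y
  have S: "integrable (gauss_matrix n) S"
    unfolding S_def using mom(3) by auto
  have le: "(proj2 n Y j)\<^sup>2 \<le> S Y" for Y
    using sum_squared_le_sum_of_squares[of "\<lambda>l. (ip n (col Y j) (gvec n Y l))\<^sup>2" "{..<j}"]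
    by (simp add: S_def proj2_def power_mult[symmetric])
  show int: "integrable (gauss_matrix n) (\<lambda>Y. (proj2 n Y j)\<^sup>2)"
    using j le by (intro Bochner_Integration.integrable_bound[OF S]) (auto simp: abs_le_iff intro: order_trans[OF _ abs_ge_self])
  have "(\<integral>Y. (proj2 n Y j)\<^sup>2 \<partial>gauss_matrix n) \<le> (\<integral>Y. S Y \<partial>gauss_matrix n)"
    using le by (intro integral_mono int S)
  also have "\<dots> = (\<Sum>l<j. \<integral>Y. (ip n (col Y j) (gvec n Y l)) ^ 4 \<partial>gauss_matrix n) * real j"
    unfolding S_def using mom(3) by (simp add: Bochner_Integration.integral_sum)
  also have "\<dots> \<le> (\<Sum>l<j. 3) * real j"
    using mom(4) by (intro mult_right_mono sum_mono) auto
  finally show "(\<integral>Y. (proj2 n Y j)\<^sup>2 \<partial>gauss_matrix n) \<le> 3 * real j ^ 2"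
    by (simp add: power2_eq_square)
qed

lemma coldev_moments:
  assumes j: "j < n"
  shows "integrable (gauss_matrix n) (\<lambda>Y. (coldev n Y j)\<^sup>2)"
    and "(\<integral>Y. (coldev n Y j)\<^sup>2 \<partial>gauss_matrix n) = 2 * real n"
    and "integrable (gauss_matrix n) (\<lambda>Y. (coldev n Y j) ^ 3)"
    and "(\<integral>Y. (coldev n Y j) ^ 3 \<partial>gauss_matrix n) = 8 * real n"
    and "integrable (gauss_matrix n) (\<lambda>Y. (coldev n Y j) ^ 4)"
    and "(\<integral>Y. (coldev n Y j) ^ 4 \<partial>gauss_matrix n) \<le> 60 * real n ^ 2"
proof -
  \<comment> \<open>Absorbs \<open>48 * n\<close> into \<open>48 * n^2\<close>, which gives 60 = 12
    + 48.\<close>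
  have "real n * 1 \<le> real n * real n"
    using j by (intro mult_left_mono) auto
  then show "(\<integral>Y. (coldev n Y j) ^ 4 \<partial>gauss_matrix n) \<le> 60 * real n ^ 2"
    using has_moments_coldev[OF j] by (simp add: has_moments_def has_bochner_integral_iff power2_eq_square)
qed (use has_moments_coldev[OF j] in \<open>auto simp: has_moments_def has_bochner_integral_iff\<close>)

section \<open>First two moments of the column distance\<close>

lemma coldist_first_moment:
  assumes j: "j < n"
  shows "integrable (gauss_matrix n) (\<lambda>Y. coldist n Y j)"
    and "(\<integral>Y. coldist n Y j \<partial>gauss_matrix n) \<le> 4 + 3 * real j"
proof -
  interpret prob_space "gauss_matrix n" by (rule prob_space_gauss_matrix)
  define U where "U Y = 2 * (coldev n Y j)\<^sup>2 / real n + 3 * proj2 n Y j" for Y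
  have U: "integrable (gauss_matrix n) U"
    unfolding U_def using coldev_moments[OF j] proj2_moments[OF j] by auto
  have le: "coldist n Y j \<le> U Y" for Y
    unfolding U_def using j by (intro coldist_le) auto
  show int: "integrable (gauss_matrix n) (\<lambda>Y. coldist n Y j)"
    using j le coldist_nonneg by (intro Bochner_Integration.integrable_bound[OF U]) (auto intro: order_trans[OF _ abs_ge_self])
  have "0 \<le> (\<integral>Y. degenerate n Y l \<partial>gauss_matrix n)" for l
    by (intro Bochner_Integration.integral_nonneg) auto
  then have "0 \<le> (\<Sum>l<j. \<integral>Y. degenerate n Y l \<partial>gauss_matrix n)"
    by (intro sum_nonneg)
  then have p: "(\<integral>Y. proj2 n Y j \<partial>gauss_matrix n) \<le> real j"
    using proj2_moments(2)[OF j] by simp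
  have "(\<integral>Y. coldist n Y j \<partial>gauss_matrix n) \<le> (\<integral>Y. U Y \<partial>gauss_matrix n)"
    using le by (intro integral_mono int U)
  also have "\<dots> = 2 * (2 * real n) / real n + 3 * (\<integral>Y. proj2 n Y j \<partial>gauss_matrix n)"
    unfolding U_def using coldev_moments(1,2)[OF j] proj2_moments(1)[OF j] by simp
  also have "\<dots> \<le> 4 + 3 * real j"
    using p j by simp
  finally show "(\<integral>Y. coldist n Y j \<partial>gauss_matrix n) \<le> 4 + 3 * real j" .
qed

lemma coldist_second_moment:
  assumes j: "j < n"
  shows "integrable (gauss_matrix n) (\<lambda>Y. (coldist n Y j)\<^sup>2)"
    and "(\<integral>Y. (coldist n Y j)\<^sup>2 \<partial>gauss_matrix n) \<le> 480 + 54 * real j ^ 2"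
proof -
  \<comment> \<open>From \<open>(a + b)^2 \<le> 2 * a^2 + 2 * b^2\<close> with the two summands of
    \<open>coldist_le\<close>: 8 = 2 * 4 and 18 = 2 * 9.\<close>
  define U where "U Y = 8 * (coldev n Y j) ^ 4 / real n ^ 2 + 18 * (proj2 n Y j)\<^sup>2" for Y
  have U: "integrable (gauss_matrix n) U"
    unfolding U_def using coldev_moments[OF j] proj2_moments[OF j] by auto
  have le: "(coldist n Y j)\<^sup>2 \<le> U Y" for Y
  proof -
    define a where "a = 2 * (coldev n Y j)\<^sup>2 / real n"
    define b where "b = 3 * proj2 n Y j"
    have "(coldist n Y j)\<^sup>2 \<le> (a + b)\<^sup>2"
      unfolding a_def b_def using j by (intro power_mono coldist_le coldist_nonneg) auto
    also have "\<dots> \<le> 2 * a\<^sup>2 + 2 * b\<^sup>2"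
      using zero_le_power2[of "a - b"] by (simp add: power2_eq_square algebra_simps)
    also have "\<dots> = U Y"
      by (simp add: U_def a_def b_def power_divide power_mult_distrib power_mult[symmetric])
    finally show ?thesis .
  qed
  show int: "integrable (gauss_matrix n) (\<lambda>Y. (coldist n Y j)\<^sup>2)"
    using j le by (intro Bochner_Integration.integrable_bound[OF U]) (auto intro: order_trans[OF _ abs_ge_self])
  have "(\<integral>Y. (coldist n Y j)\<^sup>2 \<partial>gauss_matrix n) \<le> (\<integral>Y. U Y \<partial>gauss_matrix n)"
    using le by (intro integral_mono int U)
  also have "\<dots> = 8 * (\<integral>Y. (coldev n Y j) ^ 4 \<partial>gauss_matrix n) / real n ^ 2
      + 18 * (\<integral>Y. (proj2 n Y j)\<^sup>2 \<partial>gauss_matrix n)"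
    unfolding U_def using coldev_moments(5)[OF j] proj2_moments(3)[OF j] by simp
  also have "\<dots> \<le> 8 * (60 * real n ^ 2) / real n ^ 2 + 18 * (3 * real j ^ 2)"
    using coldev_moments(6)[OF j] proj2_moments(4)[OF j]
    by (intro add_mono divide_right_mono mult_left_mono) auto
  also have "\<dots> = 480 + 54 * real j ^ 2"
    using j by simp
  finally show "(\<integral>Y. (coldist n Y j)\<^sup>2 \<partial>gauss_matrix n) \<le> 480 + 54 * real j ^ 2" .
qed

lemma integral_degenerate_le:
  assumes j: "j < n"
  shows "(\<integral>Y. degenerate n Y j \<partial>gauss_matrix n) \<le> (960 + 12 * real j ^ 2) / real n ^ 2"
proof -
  define U where "U Y = 16 * (coldev n Y j) ^ 4 / real n ^ 4 + 4 * (proj2 n Y j)\<^sup>2 / real n ^ 2" for Y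
  have U: "integrable (gauss_matrix n) U"
    unfolding U_def using coldev_moments[OF j] proj2_moments[OF j] by auto
  have "degenerate n Y j \<le> U Y" for Y
    unfolding U_def using j by (intro wvec_eq_0_indicator_le) auto
  then have "(\<integral>Y. degenerate n Y j \<partial>gauss_matrix n) \<le> (\<integral>Y. U Y \<partial>gauss_matrix n)"
    by (intro integral_mono U integrable_degenerate j)
  also have "\<dots> = 16 * (\<integral>Y. (coldev n Y j) ^ 4 \<partial>gauss_matrix n) / real n ^ 4
      + 4 * (\<integral>Y. (proj2 n Y j)\<^sup>2 \<partial>gauss_matrix n) / real n ^ 2"
    unfolding U_def using coldev_moments(5)[OF j] proj2_moments(3)[OF j] by simp
  also have "\<dots> \<le> 16 * (60 * real n ^ 2) / real n ^ 4 + 4 * (3 * real j ^ 2) / real n ^ 2"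
    using coldev_moments(6)[OF j] proj2_moments(4)[OF j]
    by (intro add_mono divide_right_mono mult_left_mono) auto
  also have "\<dots> = (960 + 12 * real j ^ 2) / real n ^ 2"
    using j by (simp add: field_simps eval_nat_numeral)
  finally show ?thesis .
qed

text \<open>Expectation of the lower bound in \<open>coldist_ge\<close>. The main term
  \<open>j\<close> comes from \<open>proj2\<close>, and 1 / 2 from \<open>E A^2 / (4 * n)\<close>
  with \<open>E A^2 = 2 * n\<close>. The errors stem, in order, from degenerate earlier columns, the
  AM-GM split, the cubic term and degeneracy of column \<open>j\<close> itself.\<close>

lemma coldist_first_moment_ge:
  assumes j: "j < n"
  shows "(\<integral>Y. coldist n Y j \<partial>gauss_matrix n) \<ge> real j + 1 / 2 - real j * (960 + 12 * real j ^ 2) / real n ^ 2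
    - 5 * (real j + 1) / (4 * sqrt (real n)) - 1 / real n - (960 + 12 * real j ^ 2) / real n"
proof -
  \<comment> \<open>this weight makes both terms of the AM-GM bound in \<open>coldist_ge\<close> of order \<open>j / sqrt n\<close>\<close>
  define c where "c = (real j + 1) / sqrt (real n)"
  have n: "0 < n" and c: "0 < c"
    using j by (auto simp: c_def)
  define L where "L Y = proj2 n Y j + (coldev n Y j)\<^sup>2 / (4 * real n)
      - (c * (coldev n Y j)\<^sup>2 + (proj2 n Y j)\<^sup>2 / c) / (4 * real n) - (coldev n Y j) ^ 3 / (8 * real n ^ 2)
      - real n * degenerate n Y j" for Y
  note ints = coldev_moments(1,3)[OF j] proj2_moments(1,3)[OF j] integrable_degenerate[OF j]
  have L: "integrable (gauss_matrix n) L"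
    unfolding L_def using ints by (intro Bochner_Integration.integrable_diff Bochner_Integration.integrable_add
        integrable_divide integrable_mult_right) auto
  define d where "d l = (\<integral>Y. degenerate n Y l \<partial>gauss_matrix n)" for l
  have "(\<integral>Y. L Y \<partial>gauss_matrix n) = (\<integral>Y. proj2 n Y j \<partial>gauss_matrix n) + 2 * real n / (4 * real n)
      - (c * (2 * real n) + (\<integral>Y. (proj2 n Y j)\<^sup>2 \<partial>gauss_matrix n) / c) / (4 * real n) - 8 * real n / (8 * real n ^ 2)
      - real n * d j"
    unfolding L_def d_def using ints
    by (simp add: coldev_moments(2,4)[OF j] Bochner_Integration.integral_diff Bochner_Integration.integral_add
        del: Bochner_Integration.integral_mult_right_zero)
  moreover have "2 * real n / (4 * real n) = 1 / 2" "8 * real n / (8 * real n ^ 2) = 1 / real n"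
    using n by (auto simp: field_simps power2_eq_square)
  moreover have "(c * (2 * real n) + (\<integral>Y. (proj2 n Y j)\<^sup>2 \<partial>gauss_matrix n) / c) / (4 * real n)
      \<le> 5 * (real j + 1) / (4 * sqrt (real n))"
  proof -
    have "(\<integral>Y. (proj2 n Y j)\<^sup>2 \<partial>gauss_matrix n) / c \<le> 3 * (real j + 1)\<^sup>2 / c"
      using c proj2_moments(4)[OF j]
      by (intro divide_right_mono order_trans[OF proj2_moments(4)[OF j]] mult_left_mono power_mono) auto
    also have "\<dots> = 3 * (real j + 1) * sqrt (real n)"
      using n by (simp add: c_def field_simps power2_eq_square)
    finally have "c * (2 * real n) + (\<integral>Y. (proj2 n Y j)\<^sup>2 \<partial>gauss_matrix n) / c
        \<le> c * (2 * real n) + 3 * (real j + 1) * sqrt (real n)" by simp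
    also have "\<dots> = 5 * (real j + 1) * sqrt (real n)"
    proof -
      have "x / s * (2 * (s * s)) = 2 * x * s" if "0 < s" for x s :: real
        using that by simp
      from this[of "sqrt (real n)" "real j + 1"] show ?thesis
        using n by (simp add: c_def) (simp add: algebra_simps)
    qed
    finally have "(c * (2 * real n) + (\<integral>Y. (proj2 n Y j)\<^sup>2 \<partial>gauss_matrix n) / c) / (4 * real n)
        \<le> 5 * (real j + 1) * sqrt (real n) / (4 * real n)"
      using n by (intro divide_right_mono) auto
    also have "\<dots> = 5 * (real j + 1) / (4 * sqrt (real n))"
    proof -
      have "x * s / (4 * (s * s)) = x / (4 * s)" for x s :: real
        by simp
      from this[of "5 * (real j + 1)" "sqrt (real n)"] show ?thesis by simp
    qed
    finally show ?thesis .
  qed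
  moreover have "(\<integral>Y. proj2 n Y j \<partial>gauss_matrix n) \<ge> real j - real j * (960 + 12 * real j ^ 2) / real n ^ 2"
  proof -
    have "d l \<le> (960 + 12 * real j ^ 2) / real n ^ 2" if "l < j" for l
    proof -
      have "d l \<le> (960 + 12 * real l ^ 2) / real n ^ 2"
        unfolding d_def using that j by (intro integral_degenerate_le) auto
      also have "\<dots> \<le> (960 + 12 * real j ^ 2) / real n ^ 2"
        using that by (intro divide_right_mono add_left_mono mult_left_mono power_mono) auto
      finally show ?thesis .
    qed
    then have "(\<Sum>l<j. d l) \<le> (\<Sum>l<j. (960 + 12 * real j ^ 2) / real n ^ 2)"
      by (intro sum_mono) auto
    then show ?thesis
      using proj2_moments(2)[OF j] by (simp add: d_def)
  qed
  moreover have "real n * d j \<le> (960 + 12 * real j ^ 2) / real n"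
  proof -
    have "real n * d j \<le> real n * ((960 + 12 * real j ^ 2) / real n ^ 2)"
      unfolding d_def by (intro mult_left_mono integral_degenerate_le j) auto
    also have "\<dots> = (960 + 12 * real j ^ 2) / real n"
      using n by (simp add: power2_eq_square)
    finally show ?thesis .
  qed
  moreover have "(\<integral>Y. L Y \<partial>gauss_matrix n) \<le> (\<integral>Y. coldist n Y j \<partial>gauss_matrix n)"
  proof (intro integral_mono L coldist_first_moment j)
    fix Y
    show "L Y \<le> coldist n Y j"
      using coldist_ge[OF n c, of Y j] by (auto simp: L_def)
  qed
  ultimately show ?thesis by linarith
qed

section \<open>Exchangeability of the rows\<close>

lemma distr_reflect_rows:
  assumes ab: "\<alpha>\<^sup>2 + \<beta>\<^sup>2 = 1" "0 < \<beta>" and ik: "i < n" "k < n" "i \<noteq> k"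
  shows "distr (gauss_matrix n) (gauss_matrix n) (reflect_rows i k \<alpha> \<beta> {..<n}) = gauss_matrix n"
proof (rule measure_eqI)
  let ?G = "gauss_matrix n" and ?T = "reflect_rows i k \<alpha> \<beta> {..<n}"
  fix A assume "A \<in> sets (distr ?G ?G ?T)"
  then have A: "A \<in> sets ?G" by simp
  have T: "?T \<in> measurable ?G ?G" using ik by (intro measurable_reflect_rows) auto
  have "emeasure (distr ?G ?G ?T) A = (\<integral>\<^sup>+Y. indicator A (?T Y) \<partial>?G)"
    using A T nn_integral_distr[OF T, of "indicator A"] by simp
  also have "\<dots> = emeasure ?G A"
    using A by (subst nn_integral_reflect_rows[OF ab ik]) auto
  finally show "emeasure (distr ?G ?G ?T) A = emeasure ?G A" .
qed simp

lemma integral_reflect_rows: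
  fixes f :: "_ \<Rightarrow> real"
  assumes ab: "\<alpha>\<^sup>2 + \<beta>\<^sup>2 = 1" "0 < \<beta>" and ik: "i < n" "k < n" "i \<noteq> k"
    and f: "f \<in> borel_measurable (gauss_matrix n)"
  shows "(\<integral>Y. f (reflect_rows i k \<alpha> \<beta> {..<n} Y) \<partial>gauss_matrix n) = (\<integral>Y. f Y \<partial>gauss_matrix n)"
    and "integrable (gauss_matrix n) f \<Longrightarrow>
      integrable (gauss_matrix n) (\<lambda>Y. f (reflect_rows i k \<alpha> \<beta> {..<n} Y))"
proof -
  have T: "reflect_rows i k \<alpha> \<beta> {..<n} \<in> measurable (gauss_matrix n) (gauss_matrix n)"
    using ik by (intro measurable_reflect_rows) auto
  show "(\<integral>Y. f (reflect_rows i k \<alpha> \<beta> {..<n} Y) \<partial>gauss_matrix n) = (\<integral>Y. f Y \<partial>gauss_matrix n)"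
    using integral_distr[OF T f] by (simp add: distr_reflect_rows[OF ab ik])
  show "integrable (gauss_matrix n) f \<Longrightarrow>
      integrable (gauss_matrix n) (\<lambda>Y. f (reflect_rows i k \<alpha> \<beta> {..<n} Y))"
    using integrable_distr_eq[OF T f] by (simp add: distr_reflect_rows[OF ab ik])
qed

section \<open>Rows of the residual matrix\<close>

definition resid :: "nat \<Rightarrow> (nat \<times> nat \<Rightarrow> real) \<Rightarrow> nat \<Rightarrow> nat \<Rightarrow> real" where
  "resid n Y j i = sqrt (real n) * gvec n Y j i - Y (i, j)"

definition rowdist :: "nat \<Rightarrow> nat \<Rightarrow> (nat \<times> nat \<Rightarrow> real) \<Rightarrow> nat \<Rightarrow> real" where
  "rowdist n q Y i = (\<Sum>j<q. (resid n Y j i)\<^sup>2)"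

lemma measurable_resid [measurable]:
  "i < n \<Longrightarrow> j < n \<Longrightarrow> (\<lambda>Y. resid n Y j i) \<in> borel_measurable (gauss_matrix n)"
  unfolding resid_def by measurable

lemma measurable_rowdist [measurable]:
  "i < n \<Longrightarrow> q \<le> n \<Longrightarrow> (\<lambda>Y. rowdist n q Y i) \<in> borel_measurable (gauss_matrix n)"
  unfolding rowdist_def by (auto intro!: borel_measurable_sum borel_measurable_power measurable_resid)

lemma rowdist_nonneg: "0 \<le> rowdist n q Y i"
  by (simp add: rowdist_def sum_nonneg)

lemma resid_reflect_rows:
  assumes "\<alpha>\<^sup>2 + \<beta>\<^sup>2 = 1" "i < n" "k < n" "i \<noteq> k" and "j < n"
  shows "resid n (reflect_rows i k \<alpha> \<beta> {..<n} Y) j = reflect i k \<alpha> \<beta> (resid n Y j)"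
  unfolding resid_def gvec_reflect_rows[OF assms] using assms
  by (auto simp: reflect_rows_def reflect_def col_def fun_eq_iff algebra_simps)

text \<open>The reflection with \<alpha> = 0 and \<beta> = 1 interchanges the two rows.\<close>

lemma rowdist_swap:
  assumes "i < n" "k < n" "i \<noteq> k" "q \<le> n"
  shows "rowdist n q (reflect_rows i k 0 1 {..<n} Y) r = rowdist n q Y (Transposition.transpose i k r)"
  unfolding rowdist_def using assms
  by (intro sum.cong) (auto simp: resid_reflect_rows reflect_def Transposition.transpose_def)

text \<open>Invariance of the law under the row swap; for \<open>i = k\<close> the transposition is
  the identity, whereas reflections require distinct rows.\<close>

lemma integral_rowdist_transpose:
  assumes "i < n" "k < n" "q \<le> n" and "a < n" "b < n"
  shows "(\<integral>Y. rowdist n q Y (Transposition.transpose i k a) * rowdist n q Y (Transposition.transpose i k b) \<partial>gauss_matrix n)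
    = (\<integral>Y. rowdist n q Y a * rowdist n q Y b \<partial>gauss_matrix n)"
    and "(\<integral>Y. rowdist n q Y (Transposition.transpose i k a) \<partial>gauss_matrix n) = (\<integral>Y. rowdist n q Y a \<partial>gauss_matrix n)"
proof -
  have m: "(\<lambda>Y. rowdist n q Y a * rowdist n q Y b) \<in> borel_measurable (gauss_matrix n)"
    "(\<lambda>Y. rowdist n q Y a) \<in> borel_measurable (gauss_matrix n)"
    using assms by measurable
  show "(\<integral>Y. rowdist n q Y (Transposition.transpose i k a) * rowdist n q Y (Transposition.transpose i k b) \<partial>gauss_matrix n)
    = (\<integral>Y. rowdist n q Y a * rowdist n q Y b \<partial>gauss_matrix n)"
    using integral_reflect_rows(1)[of 0 1 i n k, OF _ _ _ _ _ m(1)] assms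
    by (cases "i = k") (auto simp: rowdist_swap)
  show "(\<integral>Y. rowdist n q Y (Transposition.transpose i k a) \<partial>gauss_matrix n) = (\<integral>Y. rowdist n q Y a \<partial>gauss_matrix n)"
    using integral_reflect_rows(1)[of 0 1 i n k, OF _ _ _ _ _ m(2)] assms
    by (cases "i = k") (auto simp: rowdist_swap)
qed

lemma sum_rowdist_eq_coldist: "(\<Sum>i<n. rowdist n q Y i) = (\<Sum>j<q. coldist n Y j)"
  unfolding rowdist_def coldist_def resid_def by (rule sum.swap)

lemma sum_coldist_square_le:
  assumes q: "1 \<le> q" "q \<le> n"
  shows "integrable (gauss_matrix n) (\<lambda>Y. (\<Sum>j<q. coldist n Y j)\<^sup>2)"
    and "(\<integral>Y. (\<Sum>j<q. coldist n Y j)\<^sup>2 \<partial>gauss_matrix n) \<le> 534 * real q ^ 4"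
proof -
  define U where "U Y = (\<Sum>j<q. (coldist n Y j)\<^sup>2) * real q" for Y
  note mom = coldist_second_moment[OF less_le_trans[OF _ q(2)]]
  have U: "integrable (gauss_matrix n) U"
    unfolding U_def using mom(1) by auto
  have le: "(\<Sum>j<q. coldist n Y j)\<^sup>2 \<le> U Y" for Y
    using sum_squared_le_sum_of_squares[of "coldist n Y" "{..<q}"] by (simp add: U_def)
  have "(\<lambda>Y. (\<Sum>j<q. coldist n Y j)\<^sup>2) \<in> borel_measurable (gauss_matrix n)"
    using q by (auto intro!: borel_measurable_power borel_measurable_sum measurable_coldist)
  then show int: "integrable (gauss_matrix n) (\<lambda>Y. (\<Sum>j<q. coldist n Y j)\<^sup>2)"
    using le by (intro Bochner_Integration.integrable_bound[OF U]) (auto intro: order_trans[OF _ abs_ge_self])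
  have "(\<integral>Y. (\<Sum>j<q. coldist n Y j)\<^sup>2 \<partial>gauss_matrix n) \<le> (\<integral>Y. U Y \<partial>gauss_matrix n)"
    using le by (intro integral_mono int U)
  also have "\<dots> = (\<Sum>j<q. \<integral>Y. (coldist n Y j)\<^sup>2 \<partial>gauss_matrix n) * real q"
    unfolding U_def using mom(1) by (simp add: Bochner_Integration.integral_sum)
  \<comment> \<open>534 = 480 + 54, by \<open>j \<le> q\<close> and
    \<open>1 \<le> q\<close>.\<close>
  also have "\<dots> \<le> (\<Sum>j<q. 534 * real q ^ 2) * real q"
  proof (intro mult_right_mono sum_mono)
    fix j assume j: "j \<in> {..<q}"
    then have "real j ^ 2 \<le> real q ^ 2" "1 \<le> real q ^ 2"
      using q by (auto intro: power_mono)
    moreover have "(\<integral>Y. (coldist n Y j)\<^sup>2 \<partial>gauss_matrix n) \<le> 480 + 54 * real j ^ 2"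
      using mom(2) j by simp
    ultimately show "(\<integral>Y. (coldist n Y j)\<^sup>2 \<partial>gauss_matrix n) \<le> 534 * real q ^ 2"
      by linarith
  qed simp
  also have "\<dots> = 534 * real q ^ 4"
    by (simp add: eval_nat_numeral)
  finally show "(\<integral>Y. (\<Sum>j<q. coldist n Y j)\<^sup>2 \<partial>gauss_matrix n) \<le> 534 * real q ^ 4" .
qed

lemma integrable_rowdist:
  assumes "q \<le> n" "i < n"
  shows "integrable (gauss_matrix n) (\<lambda>Y. rowdist n q Y i)"
proof -
  have U: "integrable (gauss_matrix n) (\<lambda>Y. \<Sum>i<n. rowdist n q Y i)"
    unfolding sum_rowdist_eq_coldist using assms by (auto intro!: coldist_first_moment)
  have le: "rowdist n q Y i \<le> (\<Sum>i<n. rowdist n q Y i)" for Y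
    using assms by (intro member_le_sum) (auto simp: rowdist_nonneg)
  show ?thesis
    using assms le by (intro Bochner_Integration.integrable_bound[OF U])
      (auto simp: rowdist_nonneg intro: order_trans[OF _ abs_ge_self])
qed

text \<open>The product is dominated by the square of the sum over all rows, which is also the sum
  over columns, where moments are known.\<close>

lemma integrable_rowdist_mult:
  assumes "1 \<le> q" "q \<le> n" "i < n" "k < n"
  shows "integrable (gauss_matrix n) (\<lambda>Y. rowdist n q Y i * rowdist n q Y k)"
proof -
  have U: "integrable (gauss_matrix n) (\<lambda>Y. (\<Sum>i<n. rowdist n q Y i)\<^sup>2)"
    unfolding sum_rowdist_eq_coldist using assms by (intro sum_coldist_square_le)
  have le: "rowdist n q Y i \<le> (\<Sum>i<n. rowdist n q Y i)" if "i < n" for Y i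
    using that by (intro member_le_sum) (auto simp: rowdist_nonneg)
  have "rowdist n q Y i * rowdist n q Y k \<le> (\<Sum>i<n. rowdist n q Y i)\<^sup>2" for Y
    unfolding power2_eq_square using assms
    by (intro mult_mono le) (auto simp: rowdist_nonneg sum_nonneg)
  moreover have "(\<lambda>Y. rowdist n q Y i * rowdist n q Y k) \<in> borel_measurable (gauss_matrix n)"
    using assms by measurable
  ultimately show ?thesis
    by (intro Bochner_Integration.integrable_bound[OF U])
      (auto simp: rowdist_nonneg abs_mult)
qed

lemma integral_sum_rowdist:
  assumes n: "0 < n" and pq: "p \<le> n" "q \<le> n"
  shows "(\<integral>Y. (\<Sum>i<p. rowdist n q Y i) \<partial>gauss_matrix n)
    = real p / real n * (\<Sum>j<q. \<integral>Y. coldist n Y j \<partial>gauss_matrix n)"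
proof -
  define m where "m = (\<integral>Y. rowdist n q Y 0 \<partial>gauss_matrix n)"
  have m: "(\<integral>Y. rowdist n q Y i \<partial>gauss_matrix n) = m" if "i < n" for i
    using integral_rowdist_transpose(2)[of i n 0 q i] that n pq by (simp add: m_def)
  have *: "(\<integral>Y. (\<Sum>i<p. rowdist n q Y i) \<partial>gauss_matrix n) = real p * m" if "p \<le> n" for p
    using that pq m by (subst Bochner_Integration.integral_sum) (auto intro: integrable_rowdist)
  \<comment> \<open>For \<open>p = n\<close> the row sum is a column sum, which determines the
    common mean \<open>m\<close>.\<close>
  have "real n * m = (\<integral>Y. (\<Sum>j<q. coldist n Y j) \<partial>gauss_matrix n)"
    using *[OF order_refl] by (simp add: sum_rowdist_eq_coldist)
  also have "\<dots> = (\<Sum>j<q. \<integral>Y. coldist n Y j \<partial>gauss_matrix n)"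
    using pq by (intro Bochner_Integration.integral_sum coldist_first_moment) auto
  finally have "real n * m = (\<Sum>j<q. \<integral>Y. coldist n Y j \<partial>gauss_matrix n)" .
  then show ?thesis
    using *[OF pq(1)] n by (simp add: field_simps)
qed

text \<open>Reflecting rows \<open>i\<close> and \<open>k\<close> with \<open>\<alpha> = \<beta> = 1 / sqrt 2\<close> replaces the residual rows \<open>x\<close>, \<open>y\<close> by
  \<open>(x + y) / sqrt 2\<close> and \<open>(x - y) / sqrt 2\<close>; comparing the fourth moments controls the diagonal terms by
  the mixed one.\<close>

lemma integral_rowdist_square_le:
  assumes q: "1 \<le> q" "q \<le> n" and ik: "i < n" "k < n" "i \<noteq> k"
  shows "(\<integral>Y. (rowdist n q Y i)\<^sup>2 \<partial>gauss_matrix n) \<le> 6 * (\<integral>Y. rowdist n q Y i * rowdist n q Y k \<partial>gauss_matrix n)"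
proof -
  let ?G = "gauss_matrix n" and ?s = "1 / sqrt 2 :: real"
  let ?T = "reflect_rows i k ?s ?s {..<n}"
  let ?R = "\<lambda>Y. rowdist n q Y i" and ?Q = "\<lambda>Y. rowdist n q Y k"
  have s: "?s\<^sup>2 + ?s\<^sup>2 = 1" "0 < ?s" by (auto simp: power_divide)
  have int: "integrable ?G (\<lambda>Y. (?R Y)\<^sup>2)" "integrable ?G (\<lambda>Y. (?Q Y)\<^sup>2)" "integrable ?G (\<lambda>Y. ?R Y * ?Q Y)"
    unfolding power2_eq_square using assms by (auto intro!: integrable_rowdist_mult)
  define F where "F Y = (?R Y)\<^sup>2 + (?Q Y)\<^sup>2" for Y
  have F: "integrable ?G F" unfolding F_def using int by auto
  then have Fm: "F \<in> borel_measurable ?G" by auto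
  have le: "F (?T Y) \<le> F Y / 2 + 3 * (?R Y * ?Q Y)" for Y
  proof -
    define x where "x j = resid n Y j i" for j
    define y where "y j = resid n Y j k" for j
    define S where "S = (\<Sum>j<q. x j * y j)"
    have R: "?R Y = (\<Sum>j<q. (x j)\<^sup>2)" "?Q Y = (\<Sum>j<q. (y j)\<^sup>2)"
      by (simp_all add: rowdist_def x_def y_def)
    have x': "(?s * a + ?s * b)\<^sup>2 = (a\<^sup>2 + b\<^sup>2) / 2 + a * b" "(?s * a - ?s * b)\<^sup>2 = (a\<^sup>2 + b\<^sup>2) / 2 - a * b"
      for a b :: real
      by (simp_all add: power2_eq_square field_simps)
    have "rowdist n q (?T Y) i = (\<Sum>j<q. (?s * x j + ?s * y j)\<^sup>2)"
      unfolding rowdist_def using q ik s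
      by (intro sum.cong) (auto simp: resid_reflect_rows reflect_def x_def y_def)
    then have 1: "rowdist n q (?T Y) i = (?R Y + ?Q Y) / 2 + S"
      unfolding x' R S_def by (simp add: sum.distrib sum_divide_distrib add_divide_distrib)
    have "rowdist n q (?T Y) k = (\<Sum>j<q. (?s * x j - ?s * y j)\<^sup>2)"
      unfolding rowdist_def using q ik s
      by (intro sum.cong) (auto simp: resid_reflect_rows reflect_def x_def y_def)
    then have 2: "rowdist n q (?T Y) k = (?R Y + ?Q Y) / 2 - S"
      unfolding x' R S_def by (simp add: sum.distrib sum_subtractf sum_divide_distrib add_divide_distrib)
    have "S\<^sup>2 \<le> ?R Y * ?Q Y"
      unfolding S_def R by (rule Cauchy_Schwarz_ineq_sum)
    \<comment> \<open>The terms linear in \<open>S\<close> have opposite signs in the two rows and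
      cancel.\<close>
    moreover have "F (?T Y) = F Y / 2 + ?R Y * ?Q Y + 2 * S\<^sup>2"
      unfolding F_def 1 2 by (simp add: power2_eq_square field_simps)
    ultimately show ?thesis by linarith
  qed
  \<comment> \<open>By invariance the expectation of \<open>F\<close> occurs on both sides; the
    factor 1 / 2 lets it be absorbed, which turns 3 into 6.\<close>
  have "(\<integral>Y. F Y \<partial>?G) = (\<integral>Y. F (?T Y) \<partial>?G)"
    using integral_reflect_rows(1)[OF s ik Fm] by simp
  also have "\<dots> \<le> (\<integral>Y. F Y / 2 + 3 * (?R Y * ?Q Y) \<partial>?G)"
    using le int F by (intro integral_mono integral_reflect_rows(2)[OF s ik Fm]) auto
  also have "\<dots> = (\<integral>Y. F Y \<partial>?G) / 2 + 3 * (\<integral>Y. ?R Y * ?Q Y \<partial>?G)"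
    using int F by simp
  finally have "(\<integral>Y. F Y \<partial>?G) \<le> 6 * (\<integral>Y. ?R Y * ?Q Y \<partial>?G)" by simp
  moreover have "(\<integral>Y. (?R Y)\<^sup>2 \<partial>?G) \<le> (\<integral>Y. F Y \<partial>?G)"
    using int F by (intro integral_mono) (auto simp: F_def)
  ultimately show ?thesis by linarith
qed

lemma integral_sum_rowdist_square_le:
  assumes n: "2 \<le> n" and p: "p \<le> n" and q: "1 \<le> q" "q \<le> n"
  shows "integrable (gauss_matrix n) (\<lambda>Y. (\<Sum>i<p. rowdist n q Y i)\<^sup>2)"
    and "(\<integral>Y. (\<Sum>i<p. rowdist n q Y i)\<^sup>2 \<partial>gauss_matrix n) \<le> 6408 * (real p * real q ^ 2 / real n)\<^sup>2"
proof -
  define e where "e a b = (\<integral>Y. rowdist n q Y a * rowdist n q Y b \<partial>gauss_matrix n)" for a b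
  have e_nonneg: "0 \<le> e a b" for a b
    unfolding e_def by (intro Bochner_Integration.integral_nonneg mult_nonneg_nonneg rowdist_nonneg)
  \<comment> \<open>Two transpositions carry \<open>(a, b)\<close> to \<open>(0, 1)\<close>: the
    first sends \<open>a\<close> to 0 and \<open>b\<close> to \<open>b'\<close>, the second sends
    \<open>b'\<close> to 1 and fixes 0 because \<open>b' \<noteq> 0\<close>.\<close>
  have off: "e a b = e 0 1" if "a < n" "b < n" "a \<noteq> b" for a b
  proof -
    define b' where "b' = Transposition.transpose a 0 b"
    have b': "b' < n" "b' \<noteq> 0"
      using that n by (auto simp: b'_def Transposition.transpose_def)
    have "e a b = e 0 b'"
      using integral_rowdist_transpose(1)[of a n 0 q a b] that n q by (simp add: e_def b'_def)
    also have "\<dots> = e 0 1"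
      using integral_rowdist_transpose(1)[of b' n 1 q 0 b'] b' n q by (simp add: e_def Transposition.transpose_def)
    finally show ?thesis .
  qed
  have le: "e a b \<le> 6 * e 0 1" if "a < n" "b < n" for a b
  proof (cases "a = b")
    case True
    obtain k where k: "k < n" "k \<noteq> a"
      using n by (metis One_nat_def lessI less_le_trans numeral_2_eq_2 zero_less_Suc zero_neq_one)
    then show ?thesis
      using integral_rowdist_square_le[OF q that(1) k(1)] off[OF that(1) k(1)] True
      by (simp add: e_def power2_eq_square)
  next
    case False
    then show ?thesis using off[OF that False] e_nonneg[of 0 1] by simp
  qed
  have sq: "(\<Sum>i<p. rowdist n q Y i)\<^sup>2 = (\<Sum>a<p. \<Sum>b<p. rowdist n q Y a * rowdist n q Y b)" for Y p
    by (simp add: power2_eq_square sum_product)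
  have int: "integrable (gauss_matrix n) (\<lambda>Y. (\<Sum>i<p. rowdist n q Y i)\<^sup>2)"
    and E: "(\<integral>Y. (\<Sum>i<p. rowdist n q Y i)\<^sup>2 \<partial>gauss_matrix n) = (\<Sum>a<p. \<Sum>b<p. e a b)" if "p \<le> n" for p
  proof -
    have i: "integrable (gauss_matrix n) (\<lambda>Y. rowdist n q Y a * rowdist n q Y b)" if "a < p" "b < p" for a b
      using that \<open>p \<le> n\<close> q by (intro integrable_rowdist_mult) auto
    show "integrable (gauss_matrix n) (\<lambda>Y. (\<Sum>i<p. rowdist n q Y i)\<^sup>2)"
      unfolding sq using i by (intro Bochner_Integration.integrable_sum) auto
    have "(\<integral>Y. (\<Sum>i<p. rowdist n q Y i)\<^sup>2 \<partial>gauss_matrix n)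
        = (\<Sum>a<p. \<integral>Y. (\<Sum>b<p. rowdist n q Y a * rowdist n q Y b) \<partial>gauss_matrix n)"
      unfolding sq using i by (intro Bochner_Integration.integral_sum Bochner_Integration.integrable_sum) auto
    also have "\<dots> = (\<Sum>a<p. \<Sum>b<p. e a b)"
      unfolding e_def using i by (intro sum.cong refl Bochner_Integration.integral_sum) auto
    finally show "(\<integral>Y. (\<Sum>i<p. rowdist n q Y i)\<^sup>2 \<partial>gauss_matrix n) = (\<Sum>a<p. \<Sum>b<p. e a b)" .
  qed
  show "integrable (gauss_matrix n) (\<lambda>Y. (\<Sum>i<p. rowdist n q Y i)\<^sup>2)"
    by (rule int[OF p])
  \<comment> \<open>Of the second moment over all \<open>n\<close> rows only the
    \<open>n * (n - 1) \<ge> n^2 / 2\<close> off-diagonal terms are kept. The column bound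
    \<open>534 * q^4\<close> then limits \<open>e 0 1\<close>, with 1068 = 2 * 534; the final
    constant is 6408 = 6 * 1068.\<close>
  have "real n * (real n / 2) * e 0 1 \<le> real n * (real n - 1) * e 0 1"
    using n e_nonneg by (intro mult_right_mono mult_left_mono) auto
  also have "\<dots> = (\<Sum>a<n. \<Sum>b\<in>{..<n} - {a}. e 0 1)"
    using n by (simp add: of_nat_diff)
  also have "\<dots> \<le> (\<Sum>a<n. \<Sum>b<n. e a b)"
  proof (intro sum_mono)
    fix a assume "a \<in> {..<n}"
    then have "(\<Sum>b\<in>{..<n} - {a}. e 0 1) = (\<Sum>b\<in>{..<n} - {a}. e a b)"
      by (intro sum.cong refl off[symmetric]) auto
    also have "\<dots> \<le> (\<Sum>b<n. e a b)"
      by (intro sum_mono2) (auto simp: e_nonneg)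
    finally show "(\<Sum>b\<in>{..<n} - {a}. e 0 1) \<le> (\<Sum>b<n. e a b)" .
  qed
  also have "\<dots> \<le> 534 * real q ^ 4"
    using E[of n] sum_coldist_square_le(2)[OF q] by (simp add: sum_rowdist_eq_coldist)
  finally have e01: "e 0 1 \<le> 1068 * real q ^ 4 / real n ^ 2"
    using n by (simp add: field_simps power2_eq_square)
  have "(\<integral>Y. (\<Sum>i<p. rowdist n q Y i)\<^sup>2 \<partial>gauss_matrix n) \<le> (\<Sum>a<p. \<Sum>b<p. 6 * e 0 1)"
    unfolding E[OF p] using p by (intro sum_mono le) auto
  also have "\<dots> = 6 * real p ^ 2 * e 0 1"
    by (simp add: power2_eq_square)
  also have "\<dots> \<le> 6 * real p ^ 2 * (1068 * real q ^ 4 / real n ^ 2)"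
    by (intro mult_left_mono e01) auto
  also have "\<dots> = 6408 * (real p * real q ^ 2 / real n)\<^sup>2"
    by (simp add: power_divide power_mult_distrib power_mult[symmetric])
  finally show "(\<integral>Y. (\<Sum>i<p. rowdist n q Y i)\<^sup>2 \<partial>gauss_matrix n) \<le> 6408 * (real p * real q ^ 2 / real n)\<^sup>2" .
qed

section \<open>Concentration\<close>

lemma hs_dist_eq:
  assumes "q \<le> n"
  shows "hs_dist n p q Y = sqrt (\<Sum>i<p. rowdist n q Y i)"
  unfolding hs_dist_def rowdist_def resid_def using assms
  by (intro arg_cong[where f=sqrt] sum.cong) (auto simp: gamma_eq_gvec)

lemma integrable_sum_rowdist:
  assumes "p \<le> n" "q \<le> n"
  shows "integrable (gauss_matrix n) (\<lambda>Y. \<Sum>i<p. rowdist n q Y i)"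
  using assms by (auto intro!: Bochner_Integration.integrable_sum integrable_rowdist)

lemma integral_sum_rowdist_le:
  assumes n: "0 < n" and p: "p \<le> n" and q: "1 \<le> q" "q \<le> n"
  shows "(\<integral>Y. (\<Sum>i<p. rowdist n q Y i) \<partial>gauss_matrix n) \<le> 7 * (real p * real q ^ 2 / real n)"
proof -
  \<comment> \<open>The constant 7 arises from \<open>4 + 3 * j \<le> 7 * q\<close> for
    \<open>j < q\<close>.\<close>
  have "(\<Sum>j<q. \<integral>Y. coldist n Y j \<partial>gauss_matrix n) \<le> (\<Sum>j<q. 7 * real q)"
  proof (intro sum_mono)
    fix j assume "j \<in> {..<q}"
    then show "(\<integral>Y. coldist n Y j \<partial>gauss_matrix n) \<le> 7 * real q"
      using coldist_first_moment(2)[of j n] q by simp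
  qed
  then have "real p / real n * (\<Sum>j<q. \<integral>Y. coldist n Y j \<partial>gauss_matrix n) \<le> real p / real n * (real q * (7 * real q))"
    by (intro mult_left_mono) auto
  then show ?thesis
    by (simp add: integral_sum_rowdist[OF n p q(2)] power2_eq_square mult.assoc mult.left_commute)
qed

lemma integral_sum_rowdist_ge:
  assumes n: "0 < n" and p: "p \<le> n" and q: "1 \<le> q" "q \<le> n"
  shows "(\<integral>Y. (\<Sum>i<p. rowdist n q Y i) \<partial>gauss_matrix n)
    \<ge> real p * real q ^ 2 / real n * (1 / 2 - (1921 / real n + 2 / sqrt (real n) + 24 * (real q / real n)))"
proof -
  \<comment> \<open>Collects the errors of \<open>coldist_first_moment_ge\<close> relative to
    \<open>q\<close>: 1921 = 960 + 960 + 1 and 24 = 12 + 12, while 2 replaces 5 / 4.\<close>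
  define \<delta> where "\<delta> = 1921 / real n + 2 / sqrt (real n) + 24 * (real q / real n)"
  have "(\<Sum>j<q. real j + 1 / 2 - real q * \<delta>) \<le> (\<Sum>j<q. \<integral>Y. coldist n Y j \<partial>gauss_matrix n)"
  proof (intro sum_mono)
    fix j assume "j \<in> {..<q}"
    then have j: "real j + 1 \<le> real q" "j < n" "real j \<le> real n" "real j \<le> real q" using q by auto
    have q1: "1 \<le> real q" using q by auto
    have jq: "real j ^ 2 \<le> real q * real q"
      unfolding power2_eq_square using j by (intro mult_mono) auto
    have 2: "(960 + 12 * real j ^ 2) / real n \<le> real q * (960 / real n + 12 * (real q / real n))"
    proof -
      have "(960 + 12 * real j ^ 2) / real n \<le> (960 * real q + 12 * (real q * real q)) / real n"
        using jq q1 by (intro divide_right_mono) auto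
      then show ?thesis by (simp add: add_divide_distrib algebra_simps)
    qed
    \<comment> \<open>The factor \<open>j / n \<le> 1\<close> is given away, so that the first error
      is bounded like the last.\<close>
    have "real j * (960 + 12 * real j ^ 2) / real n ^ 2 = real j / real n * ((960 + 12 * real j ^ 2) / real n)"
      by (simp add: power2_eq_square)
    also have "\<dots> \<le> 1 * ((960 + 12 * real j ^ 2) / real n)"
      using j n by (intro mult_right_mono) auto
    finally have 1: "real j * (960 + 12 * real j ^ 2) / real n ^ 2 \<le> real q * (960 / real n + 12 * (real q / real n))"
      using 2 by simp
    have "5 * (real j + 1) / (4 * sqrt (real n)) = 5 / 4 * ((real j + 1) / sqrt (real n))"
      by simp
    also have "\<dots> \<le> 2 * (real q / sqrt (real n))"
      using j by (intro mult_mono divide_right_mono) auto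
    finally have 3: "5 * (real j + 1) / (4 * sqrt (real n)) \<le> real q * (2 / sqrt (real n))" by simp
    have 4: "1 / real n \<le> real q * (1 / real n)"
      using q1 n by (simp add: divide_right_mono)
    have "real q * \<delta> = real q * (960 / real n + 12 * (real q / real n)) + real q * (960 / real n + 12 * (real q / real n))
      + real q * (2 / sqrt (real n)) + real q * (1 / real n)"
      unfolding \<delta>_def by (simp add: algebra_simps)
    then show "real j + 1 / 2 - real q * \<delta> \<le> (\<integral>Y. coldist n Y j \<partial>gauss_matrix n)"
      using coldist_first_moment_ge[OF j(2)] 1 2 3 4 by linarith
  qed
  moreover have "(\<Sum>j<q. real j + 1 / 2 - real q * \<delta>) = real q ^ 2 * (1 / 2 - \<delta>)"
  proof -
    \<comment> \<open>The summands 1 / 2 make the sum exactly \<open>m^2 / 2\<close>, which matters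
      when \<open>q\<close> stays bounded.\<close>
    have "(\<Sum>j<m. real j + 1 / 2) = real m ^ 2 / 2" for m
      by (induction m) (simp_all add: power2_eq_square field_simps)
    then have "(\<Sum>j<q. (real j + 1 / 2) - real q * \<delta>) = real q ^ 2 / 2 - real q * (real q * \<delta>)"
      unfolding sum_subtractf by simp
    then show ?thesis by (simp add: power2_eq_square algebra_simps)
  qed
  ultimately have "real p / real n * (real q ^ 2 * (1 / 2 - \<delta>))
      \<le> real p / real n * (\<Sum>j<q. \<integral>Y. coldist n Y j \<partial>gauss_matrix n)"
    by (intro mult_left_mono) auto
  then show ?thesis
    unfolding integral_sum_rowdist[OF n p q(2)] \<delta>_def[symmetric] by (simp add: mult.assoc)
qed

text \<open>AM-GM on the event and \<open>Z \<le> t\<close> off it give a pointwise bound, which is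
  integrated in place of an appeal to Cauchy-Schwarz.\<close>

lemma (in prob_space) paley_zygmund:
  assumes Z: "integrable M Z" "integrable M (\<lambda>x. (Z x)\<^sup>2)" and t: "0 \<le> t"
    and d: "0 < d" "t + d \<le> expectation Z" and B: "0 < B" "expectation (\<lambda>x. (Z x)\<^sup>2) \<le> B"
  shows "d\<^sup>2 / B \<le> prob {x \<in> space M. t \<le> Z x}"
proof -
  define A where "A = {x \<in> space M. t \<le> Z x}"
  have [measurable]: "Z \<in> borel_measurable M" using Z by auto
  have A[measurable]: "A \<in> sets M" unfolding A_def by measurable
  \<comment> \<open>This weight gives \<open>c * B = d\<close>, so that half of \<open>d\<close> is
    left for the probability term.\<close>
  define c where "c = d / B"
  have c: "0 < c" using d B by (simp add: c_def)
  have iA: "integrable M (\<lambda>x. indicator A x :: real)"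
    by (intro integrable_const_bound[of _ 1]) auto
  have "Z x \<le> t + (c * (Z x)\<^sup>2 + indicator A x / c) / 2" if "x \<in> space M" for x
  proof (cases "x \<in> A")
    case True
    have "0 \<le> (c * Z x - 1)\<^sup>2 / c" using c by simp
    then have "2 * Z x \<le> c * (Z x)\<^sup>2 + 1 / c"
      using c by (simp add: power2_eq_square field_simps)
    then have "Z x \<le> (c * (Z x)\<^sup>2 + 1 / c) / 2" by (simp add: field_simps)
    then show ?thesis using True t by (simp add: add_increasing)
  next
    case False
    then have "Z x \<le> t" using that by (simp add: A_def)
    moreover have "0 \<le> c * (Z x)\<^sup>2" using c by simp
    ultimately show ?thesis using False by simp
  qed
  then have "expectation Z \<le> expectation (\<lambda>x. t + (c * (Z x)\<^sup>2 + indicator A x / c) / 2)"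
    using Z iA by (intro integral_mono) auto
  also have "\<dots> = t + (c * expectation (\<lambda>x. (Z x)\<^sup>2) + prob A / c) / 2"
    using Z iA by (simp add: prob_space)
  also have "\<dots> \<le> t + (c * B + prob A / c) / 2"
    using c B by (intro add_left_mono divide_right_mono add_right_mono mult_left_mono) auto
  also have "\<dots> = t + d / 2 + prob A * B / d / 2"
    using B by (simp add: c_def add_divide_distrib)
  finally have "d / 2 \<le> prob A * B / d / 2"
    using d(2) by linarith
  then have "d \<le> prob A * B / d" by simp
  then have "d\<^sup>2 \<le> prob A * B"
    using d by (simp add: field_simps power2_eq_square)
  then show ?thesis
    using B by (simp add: A_def field_simps)
qed

section \<open>The two regimes of \<open>p q^2 / n\<close>\<close>

theorem theorem1p2:
  fixes p q :: "nat \<Rightarrow> nat"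
  assumes "\<And>n. n \<ge> 1 \<Longrightarrow> 1 \<le> p n \<and> p n \<le> n"
      and "\<And>n. n \<ge> 1 \<Longrightarrow> 1 \<le> q n \<and> q n \<le> n"
  shows "((\<lambda>n. real (p n) * real (q n) ^ 2 / real n) \<longlonglongrightarrow> 0 \<longrightarrow>
            (\<forall>\<epsilon>>0. (\<lambda>n. measure (gauss_matrix n)
                 {Y \<in> space (gauss_matrix n). hs_dist n (p n) (q n) Y > \<epsilon>}) \<longlonglongrightarrow> 0))
       \<and> (\<forall>\<sigma>>0. (\<lambda>n. real (p n) * real (q n) ^ 2 / real n) \<longlonglongrightarrow> \<sigma> \<longrightarrow>
            (\<forall>\<epsilon>. 0 < \<epsilon> \<and> \<epsilon> < sqrt (\<sigma> / 2) \<longrightarrow>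
               liminf (\<lambda>n. ereal (measure (gauss_matrix n)
                 {Y \<in> space (gauss_matrix n). hs_dist n (p n) (q n) Y \<ge> \<epsilon>})) > 0))"
proof (intro conjI allI impI)
  define x where "x n = real (p n) * real (q n) ^ 2 / real n" for n
  define Z where "Z n Y = (\<Sum>i<p n. rowdist n (q n) Y i)" for n Y
  have Z_nonneg: "0 \<le> Z n Y" for n Y
    by (simp add: Z_def sum_nonneg rowdist_nonneg)
  have pq: "1 \<le> p n" "p n \<le> n" "1 \<le> q n" "q n \<le> n" if "1 \<le> n" for n
    using assms that by auto
  have Z_int: "integrable (gauss_matrix n) (Z n)" if "1 \<le> n" for n
    unfolding Z_def using pq[OF that] by (intro integrable_sum_rowdist)
  {
    fix \<epsilon> :: real
    assume lim: "(\<lambda>n. real (p n) * real (q n) ^ 2 / real n) \<longlonglongrightarrow> 0" and \<epsilon>: "0 < \<epsilon>"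
    have le: "measure (gauss_matrix n) {Y \<in> space (gauss_matrix n). hs_dist n (p n) (q n) Y > \<epsilon>}
        \<le> 7 * x n / \<epsilon>\<^sup>2" if n: "1 \<le> n" for n
    proof -
      interpret prob_space "gauss_matrix n" by (rule prob_space_gauss_matrix)
      have [measurable]: "Z n \<in> borel_measurable (gauss_matrix n)" using Z_int[OF n] by auto
      have "\<epsilon>\<^sup>2 \<le> Z n Y" if "\<epsilon> < hs_dist n (p n) (q n) Y" for Y
        using that \<epsilon> pq[OF n] by (simp add: hs_dist_eq Z_def real_less_rsqrt sqrt_ge_absD)
      then have "prob {Y \<in> space (gauss_matrix n). hs_dist n (p n) (q n) Y > \<epsilon>}
          \<le> prob {Y \<in> space (gauss_matrix n). \<epsilon>\<^sup>2 \<le> Z n Y}"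
        by (intro finite_measure_mono) auto
      also have "\<dots> \<le> expectation (Z n) / \<epsilon>\<^sup>2"
        using \<epsilon> Z_int[OF n] Z_nonneg by (intro integral_Markov_inequality_measure[where A="space (gauss_matrix n)"]) auto
      also have "\<dots> \<le> 7 * x n / \<epsilon>\<^sup>2"
        unfolding Z_def x_def using n pq[OF n] by (intro divide_right_mono integral_sum_rowdist_le) auto
      finally show ?thesis .
    qed
    have "(\<lambda>n. 7 * x n / \<epsilon>\<^sup>2) \<longlonglongrightarrow> 7 * 0 / \<epsilon>\<^sup>2"
      unfolding x_def using \<epsilon> by (intro tendsto_intros lim) auto
    then have lim': "(\<lambda>n. 7 * x n / \<epsilon>\<^sup>2) \<longlonglongrightarrow> 0" by simp
    show "(\<lambda>n. measure (gauss_matrix n)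
        {Y \<in> space (gauss_matrix n). hs_dist n (p n) (q n) Y > \<epsilon>}) \<longlonglongrightarrow> 0"
      by (rule tendsto_sandwich[OF _ _ tendsto_const lim'])
        (auto intro: eventually_sequentiallyI[of 1] le)
  }
  {
    fix \<sigma> \<epsilon> :: real
    assume \<sigma>: "0 < \<sigma>" and lim: "(\<lambda>n. real (p n) * real (q n) ^ 2 / real n) \<longlonglongrightarrow> \<sigma>"
      and \<epsilon>: "0 < \<epsilon> \<and> \<epsilon> < sqrt (\<sigma> / 2)"
    \<comment> \<open>Half of the gap between \<open>\<epsilon>^2\<close> and
      \<open>\<sigma> / 2\<close>, the limit of the lower bound for the expectation of
      \<open>Z\<close>. One half enters Paley-Zygmund, the other is room for the
      convergence.\<close>
    define d where "d = (\<sigma> / 2 - \<epsilon>\<^sup>2) / 2"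
    have "\<epsilon>\<^sup>2 < (sqrt (\<sigma> / 2))\<^sup>2"
      using \<epsilon> by (intro power_strict_mono) auto
    then have d: "0 < d" using \<sigma> by (simp add: d_def)
    have x: "x \<longlonglongrightarrow> \<sigma>" using lim by (simp add: x_def[abs_def])
    have inv: "(\<lambda>n. 1 / real n) \<longlonglongrightarrow> 0" by (rule lim_1_over_n)
    have "(\<lambda>n. sqrt (x n * (1 / real n))) \<longlonglongrightarrow> sqrt (\<sigma> * 0)"
      by (intro tendsto_intros x inv)
    then have sx: "(\<lambda>n. sqrt (x n * (1 / real n))) \<longlonglongrightarrow> 0" by simp
    \<comment> \<open>As \<open>1 \<le> p\<close>, the square of \<open>q / n\<close> is at most
      \<open>p q^2 / n^2 = x / n\<close>, which tends to 0. This controls the last term of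
      \<delta>.\<close>
    have qn: "(\<lambda>n. real (q n) / real n) \<longlonglongrightarrow> 0"
    proof (rule tendsto_sandwich[OF _ _ tendsto_const sx])
      show "\<forall>\<^sub>F n in sequentially. real (q n) / real n \<le> sqrt (x n * (1 / real n))"
      proof (rule eventually_sequentiallyI[of 1])
        fix n :: nat assume n: "1 \<le> n"
        have "1 * (real (q n))\<^sup>2 \<le> real (p n) * (real (q n))\<^sup>2"
          using pq[OF n] by (intro mult_right_mono) auto
        then have "(real (q n) / real n)\<^sup>2 \<le> x n * (1 / real n)"
          by (simp add: x_def power_divide power2_eq_square divide_right_mono)
        then show "real (q n) / real n \<le> sqrt (x n * (1 / real n))"
          by (rule real_le_rsqrt)
      qed
    qed simp
    have sinv: "(\<lambda>n. 2 / sqrt (real n)) \<longlonglongrightarrow> 0"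
    proof -
      have "(\<lambda>n. 2 * sqrt (1 / real n)) \<longlonglongrightarrow> 2 * sqrt 0"
        by (intro tendsto_intros inv)
      then show ?thesis by (simp add: real_sqrt_divide)
    qed
    define \<delta> where "\<delta> n = 1921 / real n + 2 / sqrt (real n) + 24 * (real (q n) / real n)" for n
    have "(\<lambda>n. 1921 * (1 / real n) + 2 / sqrt (real n) + 24 * (real (q n) / real n)) \<longlonglongrightarrow> 1921 * 0 + 0 + 24 * 0"
      by (intro tendsto_intros inv sinv qn)
    then have \<delta>: "\<delta> \<longlonglongrightarrow> 0" by (simp add: \<delta>_def[abs_def])
    have "(\<lambda>n. x n * (1 / 2 - \<delta> n)) \<longlonglongrightarrow> \<sigma> * (1 / 2 - 0)"
      by (intro tendsto_intros x \<delta>)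
    moreover have "\<epsilon>\<^sup>2 + d < \<sigma> * (1 / 2 - 0)"
    proof -
      have "\<sigma> * (1 / 2 - 0) = \<epsilon>\<^sup>2 + 2 * d" unfolding d_def by (simp add: field_simps)
      then show ?thesis using d by linarith
    qed
    ultimately have ev1: "\<forall>\<^sub>F n in sequentially. \<epsilon>\<^sup>2 + d < x n * (1 / 2 - \<delta> n)"
      by (rule order_tendstoD(1))
    have ev2: "\<forall>\<^sub>F n in sequentially. x n < \<sigma> + 1"
      by (rule order_tendstoD(2)[OF x]) simp
    \<comment> \<open>Bounds the second moment once \<open>x n < \<sigma> + 1\<close> and makes the
      probability bound \<open>d^2 / B\<close> independent of \<open>n\<close>.\<close>
    define B where "B = 6408 * (\<sigma> + 1)\<^sup>2"
    have B: "0 < B" using \<sigma> by (simp add: B_def)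
    have "\<forall>\<^sub>F n in sequentially. ereal (d\<^sup>2 / B) \<le> ereal (measure (gauss_matrix n)
        {Y \<in> space (gauss_matrix n). hs_dist n (p n) (q n) Y \<ge> \<epsilon>})"
      using ev1 ev2 eventually_ge_at_top[of 2]
    proof eventually_elim
      case (elim n)
      then have n: "2 \<le> n" "1 \<le> n" "0 < n" by auto
      note pqn = pq[OF n(2)]
      interpret prob_space "gauss_matrix n" by (rule prob_space_gauss_matrix)
      have x0: "0 \<le> x n" by (simp add: x_def)
      have eq: "\<epsilon> \<le> hs_dist n (p n) (q n) Y \<longleftrightarrow> \<epsilon>\<^sup>2 \<le> Z n Y" for Y
        using \<epsilon> pqn real_le_rsqrt[of \<epsilon> "Z n Y"] sqrt_ge_absD[of \<epsilon> "Z n Y"]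
        by (auto simp: hs_dist_eq Z_def)
      have "expectation (\<lambda>Y. (Z n Y)\<^sup>2) \<le> 6408 * (x n)\<^sup>2"
        unfolding Z_def x_def by (rule integral_sum_rowdist_square_le(2)[OF n(1) pqn(2-4)])
      also have "\<dots> \<le> B"
        unfolding B_def using elim x0 by (intro mult_left_mono power_mono) auto
      finally have EB: "expectation (\<lambda>Y. (Z n Y)\<^sup>2) \<le> B" .
      have "x n * (1 / 2 - \<delta> n) \<le> expectation (Z n)"
        using integral_sum_rowdist_ge[OF n(3) pqn(2-4)] by (simp add: x_def \<delta>_def Z_def[abs_def])
      then have "\<epsilon>\<^sup>2 + d \<le> expectation (Z n)" using elim by linarith
      moreover have "integrable (gauss_matrix n) (\<lambda>Y. (Z n Y)\<^sup>2)"
        unfolding Z_def by (rule integral_sum_rowdist_square_le(1)[OF n(1) pqn(2-4)])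
      ultimately have "d\<^sup>2 / B \<le> prob {Y \<in> space (gauss_matrix n). \<epsilon>\<^sup>2 \<le> Z n Y}"
        using d B EB Z_int[OF n(2)] by (intro paley_zygmund) auto
      then show ?case by (simp add: eq)
    qed
    then have "ereal (d\<^sup>2 / B) \<le> liminf (\<lambda>n. ereal (measure (gauss_matrix n)
        {Y \<in> space (gauss_matrix n). hs_dist n (p n) (q n) Y \<ge> \<epsilon>}))"
      by (rule Liminf_bounded)
    moreover have "0 < ereal (d\<^sup>2 / B)" using d B by simp
    ultimately show "0 < liminf (\<lambda>n. ereal (measure (gauss_matrix n)
        {Y \<in> space (gauss_matrix n). hs_dist n (p n) (q n) Y \<ge> \<epsilon>}))"
      by (rule less_le_trans[rotated])
  }
qed

end
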